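(* Let $\Omega\subset\mathbb R^2$ be a bounded domain, $k\in\mathbb R$, and $$g(\xi)=|\xi|^4+k(\det\xi)^2,\qquad\xi\in\mathbb R^{2\times2}.$$ The function $g$ is integral convex if and only if $-2\le k\le4$, in which case $g$ is in fact convex on $\mathbb R^{2\times 2}$. Consequently, for all $4<k\le8$, $Dg$ is quasimonotone, but $g$ is not integral convex.
   Context: $\mathbb R^{2\times2}$ carries the inner product $\xi:\eta=\operatorname{tr}(\xi^T\eta)$ and norm $|\xi|=(\xi:\xi)^{1/2}$. For $u=(u^1,u^2)$, $Du=(\partial u^i/\partial x_j)$ is the Jacobian matrix. A function $f\colon\mathbb R^{2\times2}\to\mathbb R$ is integral convex if the functional $u\mapsto\int_\Omega f(Du(x))\,dx$ is convex on $W^{1,\infty}_0(\Omega;\mathbb R^2)$. A map $A\colon\mathbb R^{2\times2}\to\mathbb R^{2\times2}$ is quasimonotone if $\int_\Omega A(\xi+D\phi(x)):D\phi(x)\,dx\ge0$ for all $\xi\in\mathbb R^{2\times2}$ and $\phi\in C_0^\infty(\Omega;\mathbb R^2)$. *)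

theory Defs
  imports "HOL-Analysis.Analysis"
begin

(* The library inner product and norm on real^2^2 are entrywise, i.e. the ones
   given by tr(xi^T eta). *)
lemma inner_matrix_eq_trace:
  fixes \<xi> \<eta> :: "real^2^2"
  shows "\<xi> \<bullet> \<eta> = trace (transpose \<xi> ** \<eta>)"
  by (simp add: inner_vec_def trace_def transpose_def matrix_matrix_mult_def sum_2)

lemma norm_matrix_eq_trace:
  fixes \<xi> :: "real^2^2"
  shows "norm \<xi> = sqrt (trace (transpose \<xi> ** \<xi>))"
  by (simp only: norm_eq_sqrt_inner inner_matrix_eq_trace)

definition bounded_domain :: "(real^2) set \<Rightarrow> bool" where
  "bounded_domain \<Omega> \<longleftrightarrow> open \<Omega> \<and> connected \<Omega> \<and> bounded \<Omega> \<and> \<Omega> \<noteq> {}"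

primrec C_k :: "nat \<Rightarrow> ('a::euclidean_space \<Rightarrow> 'b::real_normed_vector) \<Rightarrow> bool" where
  "C_k 0 f \<longleftrightarrow> continuous_on UNIV f"
| "C_k (Suc n) f \<longleftrightarrow> (\<forall>x. f differentiable (at x)) \<and>
     (\<forall>b\<in>Basis. C_k n (\<lambda>x. frechet_derivative f (at x) b))"

(* Elements of C_0^infinity(Omega) are represented by their extensions by zero. *)
definition test_functions :: "(real^2) set \<Rightarrow> (real^2 \<Rightarrow> 'b::real_normed_vector) set" where
  "test_functions \<Omega> = {\<phi>. (\<forall>n. C_k n \<phi>) \<and>
     compact (closure {x. \<phi> x \<noteq> 0}) \<and> closure {x. \<phi> x \<noteq> 0} \<subseteq> \<Omega>}"

definition locally_integrable ::
    "(real^2) set \<Rightarrow> (real^2 \<Rightarrow> 'b::{banach, second_countable_topology}) \<Rightarrow> bool" where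
  "locally_integrable \<Omega> f \<longleftrightarrow>
     (\<forall>K. compact K \<and> K \<subseteq> \<Omega> \<longrightarrow> integrable (lebesgue_on K) f)"

definition L_infinity :: "(real^2) set \<Rightarrow> (real^2 \<Rightarrow> 'b::euclidean_space) set" where
  "L_infinity \<Omega> = {f. f \<in> borel_measurable (lebesgue_on \<Omega>) \<and>
     (\<exists>C. AE x in lebesgue_on \<Omega>. norm (f x) \<le> C)}"

(* Row i of G x is the weak gradient of the i-th component of u, as in jacobian. *)
definition has_weak_jacobian ::
    "(real^2) set \<Rightarrow> (real^2 \<Rightarrow> real^2) \<Rightarrow> (real^2 \<Rightarrow> real^2^2) \<Rightarrow> bool" where
  "has_weak_jacobian \<Omega> u G \<longleftrightarrow> locally_integrable \<Omega> u \<and> locally_integrable \<Omega> G \<and>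
     (\<forall>\<psi> \<in> test_functions \<Omega>. \<forall>i j.
        integral\<^sup>L (lebesgue_on \<Omega>) (\<lambda>x. u x $ i * frechet_derivative \<psi> (at x) (axis j 1)) =
        - integral\<^sup>L (lebesgue_on \<Omega>) (\<lambda>x. G x $ i $ j * (\<psi> x :: real)))"

(* Determined up to a Lebesgue null subset of \<Omega>; arbitrary if u is not weakly differentiable. *)
definition weak_jacobian ::
    "(real^2) set \<Rightarrow> (real^2 \<Rightarrow> real^2) \<Rightarrow> real^2 \<Rightarrow> real^2^2" where
  "weak_jacobian \<Omega> u = (SOME G. has_weak_jacobian \<Omega> u G)"

definition W_1_inf :: "(real^2) set \<Rightarrow> (real^2 \<Rightarrow> real^2) set" where
  "W_1_inf \<Omega> = {u. u \<in> L_infinity \<Omega> \<and>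
     (\<exists>G. has_weak_jacobian \<Omega> u G \<and> G \<in> L_infinity \<Omega>)}"

(* Closure of the test functions in the norm of W^{1,1}(\<Omega>). *)
definition W0_1_1 :: "(real^2) set \<Rightarrow> (real^2 \<Rightarrow> real^2) set" where
  "W0_1_1 \<Omega> = {u. integrable (lebesgue_on \<Omega>) u \<and>
     (\<exists>G. has_weak_jacobian \<Omega> u G \<and> integrable (lebesgue_on \<Omega>) G \<and>
       (\<exists>\<phi>. (\<forall>n. \<phi> n \<in> test_functions \<Omega>) \<and>
          (\<lambda>n::nat. integral\<^sup>L (lebesgue_on \<Omega>) (\<lambda>x. norm (u x - \<phi> n x))) \<longlonglongrightarrow> 0 \<and>
          (\<lambda>n. integral\<^sup>L (lebesgue_on \<Omega>)
                 (\<lambda>x. norm (G x - jacobian (\<phi> n) (at x)))) \<longlonglongrightarrow> 0))}"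

(* The usual convention: test functions are not dense in this space for its own norm. *)
definition W0_1_inf :: "(real^2) set \<Rightarrow> (real^2 \<Rightarrow> real^2) set" where
  "W0_1_inf \<Omega> = W_1_inf \<Omega> \<inter> W0_1_1 \<Omega>"

definition energy :: "(real^2) set \<Rightarrow> (real^2^2 \<Rightarrow> real) \<Rightarrow> (real^2 \<Rightarrow> real^2) \<Rightarrow> real" where
  "energy \<Omega> f u = integral\<^sup>L (lebesgue_on \<Omega>) (\<lambda>x. f (weak_jacobian \<Omega> u x))"

(* Convexity of the energy, written out since the function type real^2 => real^2 is
   not an instance of real_vector. Meaningful for f such that f(Du) is integrable for
   all u in W0_1_inf, e.g. f continuous. *)
definition integral_convex :: "(real^2) set \<Rightarrow> (real^2^2 \<Rightarrow> real) \<Rightarrow> bool" where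
  "integral_convex \<Omega> f \<longleftrightarrow>
     (\<forall>u \<in> W0_1_inf \<Omega>. \<forall>v \<in> W0_1_inf \<Omega>. \<forall>t \<in> {0..1}.
        energy \<Omega> f (\<lambda>x. (1 - t) *\<^sub>R u x + t *\<^sub>R v x)
          \<le> (1 - t) * energy \<Omega> f u + t * energy \<Omega> f v)"

definition quasimonotone :: "(real^2) set \<Rightarrow> (real^2^2 \<Rightarrow> real^2^2) \<Rightarrow> bool" where
  "quasimonotone \<Omega> A \<longleftrightarrow>
     (\<forall>\<xi>. \<forall>\<phi> \<in> test_functions \<Omega>.
        integral\<^sup>L (lebesgue_on \<Omega>)
          (\<lambda>x. A (\<xi> + jacobian \<phi> (at x)) \<bullet> jacobian \<phi> (at x)) \<ge> 0)"

definition gradient :: "('a::real_inner \<Rightarrow> real) \<Rightarrow> 'a \<Rightarrow> 'a" where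
  "gradient f x = (THE D. GDERIV f x :> D)"

definition g :: "real \<Rightarrow> real^2^2 \<Rightarrow> real" where
  "g k \<xi> = norm \<xi> ^ 4 + k * (det \<xi>)\<^sup>2"

end

(*
  Dg is quasimonotone for 0 <= k <= 8 because Dg(xi + eta) : eta is the null Lagrangian
  4|xi|^2 xi:eta + 2k det(xi) cof(xi):eta + 4k det(xi) det(eta) plus a remainder that is
  pointwise nonnegative, by Cauchy-Schwarz and 2|det eta| <= |eta|^2. Convexity for
  -2 <= k <= 4 holds because the second variation is affine in k and is a sum of squares
  at k = -2 and nonnegative at k = 4.

  If g is not convex along diagonal matrices, convexity of the energy is refuted by the
  oscillating maps u_i(x) = c_i zeta(x) w(N x_i) / N with w a smooth approximation of a
  zigzag of slopes +1 and -1: since g is invariant under sign changes of columns, their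
  energy tends to g(diag c) times the integral of zeta^4. For k outside [-2, 4] the restriction
  of g to diagonal matrices is indeed not convex.
*)
theory Submission
  imports Defs
begin

subsection \<open>Smooth functions\<close>

text \<open>Both convexity thresholds are visible on diagonal matrices diag(a, b), where g is a^4 +
  (2 + k) a^2 b^2 + b^4: the second variation at (1, 1) along (1, -1) has the sign of 4 - k, and at
  (1, 0) along (0, 1) that of k + 2. Maps with amplitudes c and d oscillate in phase, so their
  midpoint is again such a map, with amplitude (c + d)/2, and the Jacobians differ only by a
  diagonal left factor. Comparing the three energies thus becomes the integral of one function of a
  common matrix. The sharp zigzag is not smooth, so two limits are taken in a fixed order: smoothing
  to sharp profile at fixed frequency, then frequency to infinity. Since signs of columns do not
  matter, the integrands themselves converge almost everywhere and no averaging over oscillations is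
  required. An energy refers to an arbitrarily chosen weak Jacobian. Hence a fundamental lemma and
  almost everywhere uniqueness must come before any energy can be computed. The null Lagrangian part
  needs the integral of det(D phi) to vanish; this is obtained from translation invariance of the
  integral.\<close>

lemma C_k_SucI:
  assumes "\<And>x. (f has_derivative D x) (at x)" "\<And>b. b \<in> Basis \<Longrightarrow> C_k n (\<lambda>x. D x b)"
  shows "C_k (Suc n) f"
proof -
  have "frechet_derivative f (at x) = D x" for x
    using frechet_derivative_at[OF assms(1)] by simp
  then show ?thesis using assms by (auto simp: differentiable_def)
qed

lemma C_k_SucI_real:
  fixes f :: "real \<Rightarrow> real"
  assumes "\<And>x. (f has_real_derivative f' x) (at x)" "C_k n f'"
  shows "C_k (Suc n) f"
  using assms by (intro C_k_SucI[where D="\<lambda>x h. f' x * h"]) (auto simp: has_field_derivative_def)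

lemma C_k_SucD: "C_k (Suc n) f \<Longrightarrow> C_k n f"
proof (induction n arbitrary: f)
  case 0
  then show ?case
    by (auto intro!: continuous_at_imp_continuous_on differentiable_imp_continuous_within)
qed auto

lemma C_k_has_derivative:
  "C_k (Suc n) f \<Longrightarrow> (f has_derivative frechet_derivative f (at x)) (at x)"
  by (simp add: frechet_derivative_works)

lemma C_k_const: "C_k n (\<lambda>x. c)"
proof (induction n arbitrary: c)
  case (Suc n)
  show ?case by (rule C_k_SucI[where D="\<lambda>x h. 0"]) (use Suc in auto)
qed auto

lemma C_k_bounded_linear:
  assumes "bounded_linear f"
  shows "C_k n f"
proof (cases n)
  case 0
  then show ?thesis using assms by (simp add: linear_continuous_on)
next
  case (Suc m)
  then show ?thesis
    unfolding Suc
    by (intro C_k_SucI[where D="\<lambda>x. f"] bounded_linear_imp_has_derivative assms C_k_const)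
qed

lemma C_k_add:
  assumes "C_k n f" "C_k n q"
  shows "C_k n (\<lambda>x. f x + q x)"
  using assms
proof (induction n arbitrary: f q)
  case 0
  then show ?case by (auto intro: continuous_intros)
next
  case (Suc n)
  show ?case
    by (rule C_k_SucI) (rule has_derivative_add[OF Suc(2,3)[THEN C_k_has_derivative]],
      use Suc in auto)
qed

lemma C_k_scaleR:
  fixes f :: "'a::euclidean_space \<Rightarrow> real"
  assumes "C_k n f" "C_k n q"
  shows "C_k n (\<lambda>x. f x *\<^sub>R q x)"
  using assms
proof (induction n arbitrary: f q)
  case 0
  then show ?case by (auto intro: continuous_intros)
next
  case (Suc n)
  show ?case
    by (rule C_k_SucI) (rule has_derivative_scaleR[OF Suc(2,3)[THEN C_k_has_derivative]],
      use Suc(1) Suc(2,3)[THEN C_k_SucD] Suc(2,3) in \<open>auto intro!: C_k_add\<close>)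
qed

lemma C_k_mult:
  fixes f q :: "'a::euclidean_space \<Rightarrow> real"
  assumes "C_k n f" "C_k n q"
  shows "C_k n (\<lambda>x. f x * q x)"
  using C_k_scaleR[OF assms] by simp

text \<open>A derivative of the composite is the product of the derivative of \<open>f\<close> at
  \<open>q x\<close> and a derivative of \<open>q\<close>, so the induction must range over all
  \<open>f\<close> and \<open>q\<close> at once and rests on \<open>C_k_mult\<close>.\<close>

lemma C_k_compose:
  fixes f :: "real \<Rightarrow> real" and q :: "'a::euclidean_space \<Rightarrow> real"
  assumes "C_k n f" "C_k n q"
  shows "C_k n (\<lambda>x. f (q x))"
  using assms
proof (induction n arbitrary: f q)
  case 0
  then show ?case using continuous_on_compose[of UNIV q f] by (auto simp: o_def intro: continuous_on_subset)
next
  case (Suc n)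
  \<comment> \<open>A linear map on the reals is multiplication by its value at 1; this turns the
    chain rule into a product of scalar functions.\<close>
  have eq: "frechet_derivative f (at y) h = frechet_derivative f (at y) 1 * h" for y h
    using linear_scale[OF has_derivative_linear[OF C_k_has_derivative[OF Suc(2)]], of y h 1]
    by simp
  have "C_k n (\<lambda>x. frechet_derivative f (at (q x)) 1 * frechet_derivative q (at x) b)"
    if "b \<in> Basis" for b
    using Suc(1)[of "\<lambda>y. frechet_derivative f (at y) 1" q] Suc(2,3) C_k_SucD[OF Suc(3)] that
    by (intro C_k_mult) auto
  then show ?case
    by (intro C_k_SucI[OF has_derivative_compose[OF C_k_has_derivative[OF Suc(3)]
            C_k_has_derivative[OF Suc(2)]]]) (subst eq, simp)
qed

lemma C_k_nth: "C_k n (\<lambda>x::real^'n. x $ i)"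
  by (rule C_k_bounded_linear) (rule bounded_linear_vec_nth)

lemma C_k_nth_comp: 
  fixes f :: "'a::euclidean_space \<Rightarrow> real^'m"
  assumes "C_k n f" shows "C_k n (\<lambda>x. f x $ i)"
  using assms
proof (induction n arbitrary: f)
  case 0
  then show ?case by (auto intro: continuous_intros)
next
  case (Suc n)
  show ?case
    by (rule C_k_SucI, rule bounded_linear.has_derivative[OF bounded_linear_vec_nth], 
      rule C_k_has_derivative[OF Suc(2)]) (use Suc in auto)
qed

text \<open>The factor \<open>t\<^sup>-\<^sup>m\<close> makes the family closed under differentiation up to linear combinations.\<close>

definition exp_cutoff :: "nat \<Rightarrow> real \<Rightarrow> real" where
  "exp_cutoff m t = (if t > 0 then inverse t ^ m * exp (- inverse t) else 0)"

text \<open>With s = 1/t the limit from the right is that of s^m / exp s at infinity; on the left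
  the function is zero.\<close>

lemma exp_cutoff_tendsto_0: "(exp_cutoff m \<longlongrightarrow> 0) (at 0)"
proof -
  have "((\<lambda>t. inverse t ^ m / exp (inverse t)) \<longlongrightarrow> (0::real)) (at_right 0)"
    by (rule filterlim_compose[OF tendsto_power_div_exp_0 filterlim_inverse_at_top_right])
  then have "(exp_cutoff m \<longlongrightarrow> 0) (at_right 0)"
    by (rule tendsto_cong[THEN iffD1, rotated])
      (auto simp: eventually_at_filter exp_cutoff_def exp_minus divide_inverse)
  moreover have "(exp_cutoff m \<longlongrightarrow> 0) (at_left 0)"
    by (rule tendsto_eventually) (auto simp: eventually_at_filter exp_cutoff_def)
  ultimately show ?thesis by (simp add: filterlim_at_split)
qed

lemma exp_cutoff_has_derivative:
  "(exp_cutoff m has_real_derivative exp_cutoff (m + 2) t - m * exp_cutoff (m + 1) t) (at t)"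
proof -
  consider "t > 0" | "t < 0" | "t = 0" by linarith
  then show ?thesis
  proof cases
    case 1
    have "((\<lambda>t. inverse t ^ m * exp (- inverse t)) has_real_derivative
        exp_cutoff (m + 2) t - m * exp_cutoff (m + 1) t) (at t)"
      using 1 by (cases m) (auto intro!: derivative_eq_intros simp: exp_cutoff_def algebra_simps,
          metis power_eq_if One_nat_def)
    then show ?thesis
      by (rule has_field_derivative_transform_within_open[OF _ open_greaterThan[of 0]])
        (use 1 in \<open>auto simp: exp_cutoff_def\<close>)
  next
    case 2
    have "((\<lambda>t. 0) has_real_derivative exp_cutoff (m + 2) t - m * exp_cutoff (m + 1) t) (at t)"
      using 2 by (simp add: exp_cutoff_def)
    then show ?thesis
      by (rule has_field_derivative_transform_within_open[OF _ open_lessThan[of 0]])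
        (use 2 in \<open>auto simp: exp_cutoff_def\<close>)
  next
    case 3
    \<comment> \<open>At the origin the difference quotient of \<open>exp_cutoff m\<close> is
      \<open>exp_cutoff (m + 1)\<close> itself, since dividing by h only raises the power of
      1/h.\<close>
    have "(exp_cutoff (m + 1) \<longlongrightarrow> 0) (at 0)" by (rule exp_cutoff_tendsto_0)
    then have "((\<lambda>h. (exp_cutoff m (0 + h) - exp_cutoff m 0) / h) \<longlongrightarrow> 0) (at 0)"
      by (rule tendsto_cong[THEN iffD1, rotated])
        (auto simp: eventually_at_filter exp_cutoff_def field_simps)
    then show ?thesis using 3 by (simp add: DERIV_def exp_cutoff_def)
  qed
qed

lemma C_k_exp_cutoff: "C_k n (exp_cutoff m)"
proof (induction n arbitrary: m)
  case 0
  show ?case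
    by (auto intro!: continuous_at_imp_continuous_on DERIV_isCont exp_cutoff_has_derivative)
next
  case (Suc n)
  show ?case
    using C_k_add[OF Suc[of "m+2"] C_k_mult[OF C_k_const[of n "-real m"] Suc[of "m+1"]]]
    by (intro C_k_SucI_real[OF exp_cutoff_has_derivative]) simp
qed

lemma exp_cutoff_bounds: "0 \<le> exp_cutoff 0 t" "exp_cutoff 0 t \<le> 1"
  by (auto simp: exp_cutoff_def)

text \<open>Dilation sharpens the cutoff into a step function; products of four such steps will give
  indicators of boxes.\<close>

lemma exp_cutoff_scaled_tendsto:
  "(\<lambda>n. exp_cutoff 0 (real (Suc n) * t)) \<longlonglongrightarrow> (if t > 0 then 1 else 0)"
proof (cases "t > 0")
  case True
  have "(\<lambda>n. exp (- (inverse (real (Suc n)) * inverse t))) \<longlonglongrightarrow> exp (- (0 * inverse t))"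
    by (intro tendsto_intros LIMSEQ_inverse_real_of_nat)
  moreover have "0 < real (Suc n) * t" for n using True by simp
  ultimately show ?thesis
    using True by (simp add: exp_cutoff_def inverse_mult_distrib del: of_nat_Suc)
next
  case False
  then have "\<not> 0 < real (Suc n) * t" for n
    by (simp add: zero_less_mult_iff del: of_nat_Suc)
  then show ?thesis using False by (simp add: exp_cutoff_def del: of_nat_Suc)
qed

section \<open>Smooth approximations of the zigzag and their slopes\<close>

lemma C_k_sin_cos: "C_k n (sin :: real \<Rightarrow> real) \<and> C_k n (cos :: real \<Rightarrow> real)"
proof (induction n)
  case 0
  show ?case by (auto intro: continuous_intros)
next
  case (Suc n)
  have "C_k n (\<lambda>x::real. - sin x)"
    using C_k_mult[OF C_k_const[of n "-1"], of sin] Suc by simp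
  then show ?case
    using Suc by (auto intro!: C_k_SucI_real DERIV_sin DERIV_cos simp del: C_k.simps)
qed

text \<open>As \<open>r\<close> increases to 1, this tends to the zigzag \<open>arcsin (sin t)\<close> with slopes 1 and -1.\<close>

definition zigzag :: "real \<Rightarrow> real \<Rightarrow> real" where
  "zigzag r t = arcsin (r * sin t)"

definition zigzag' :: "real \<Rightarrow> real \<Rightarrow> real" where
  "zigzag' r t = r * cos t / sqrt (1 - (r * sin t)\<^sup>2)"

lemma one_minus_sin_pos:
  fixes r t :: real
  assumes "\<bar>r\<bar> < 1" shows "\<bar>r * sin t\<bar> < 1" "0 < 1 - (r * sin t)\<^sup>2"
proof -
  have "\<bar>r\<bar> * \<bar>sin t\<bar> \<le> \<bar>r\<bar> * 1" by (intro mult_left_mono) auto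
  then show "\<bar>r * sin t\<bar> < 1" using assms by (simp add: abs_mult)
  then show "0 < 1 - (r * sin t)\<^sup>2" by (simp add: abs_square_less_1)
qed

lemma zigzag_has_derivative:
  assumes "\<bar>r\<bar> < 1"
  shows "(zigzag r has_real_derivative zigzag' r t) (at t)"
  unfolding zigzag_def zigzag'_def
  using one_minus_sin_pos[OF assms, of t]
  by (auto intro!: derivative_eq_intros simp: abs_less_iff divide_inverse)

text \<open>Writing w for this function, w' = r^2 sin t cos t w^3, a polynomial in w, sin and cos,
  so the induction on \<open>n\<close> closes.\<close>

lemma C_k_inverse_sqrt_sin:
  assumes "\<bar>r\<bar> < 1"
  shows "C_k n (\<lambda>t. inverse (sqrt (1 - (r * sin t)\<^sup>2)))" (is "C_k n ?w")
proof (induction n)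
  case 0
  show ?case using one_minus_sin_pos(2)[OF assms] 
    by (auto intro!: continuous_intros simp: less_imp_neq[symmetric])
next
  case (Suc n)
  have *: "(?w has_real_derivative (r\<^sup>2 * (sin t * cos t)) * (?w t * (?w t * ?w t))) (at t)" for t
  proof -
    have p: "0 < 1 - (r * sin t)\<^sup>2" using one_minus_sin_pos[OF assms, of t] by simp
    then have "sqrt (1 - (r * sin t)\<^sup>2) \<noteq> 0" by auto
    with p show ?thesis
      by (auto intro!: derivative_eq_intros simp: power2_eq_square divide_simps)
  qed
  show ?case
    by (rule C_k_SucI_real[OF *]) (intro C_k_mult C_k_const Suc C_k_sin_cos[THEN conjunct1] C_k_sin_cos[THEN conjunct2])
qed

lemma C_k_zigzag:
  assumes "\<bar>r\<bar> < 1" shows "C_k n (zigzag r)"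
proof (rule C_k_SucD, rule C_k_SucI_real[OF zigzag_has_derivative[OF assms]])
  show "C_k n (zigzag' r)"
    unfolding zigzag'_def divide_inverse
    by (intro C_k_mult C_k_const C_k_sin_cos[THEN conjunct2] C_k_inverse_sqrt_sin assms)
qed

lemma zigzag_bound: assumes "\<bar>r\<bar> \<le> 1" shows "\<bar>zigzag r t\<bar> \<le> 2"
proof -
  have "\<bar>r * sin t\<bar> \<le> 1 * 1" unfolding abs_mult by (intro mult_mono assms) auto
  then have "\<bar>zigzag r t\<bar> \<le> pi / 2"
    unfolding zigzag_def using arcsin_bounded[of "r * sin t"] by (auto simp: abs_le_iff)
  then show ?thesis using pi_less_4 by linarith
qed

text \<open>The squares of \<open>r * cos t\<close> and \<open>r * sin t\<close> add up to r^2 < 1,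
  so the root dominates the numerator.\<close>

lemma zigzag'_bound: assumes "\<bar>r\<bar> < 1" shows "\<bar>zigzag' r t\<bar> \<le> 1"
proof -
  have "(r * cos t)\<^sup>2 + (r * sin t)\<^sup>2 = r\<^sup>2"
    by (simp add: power_mult_distrib sin_cos_squared_add2 flip: distrib_left)
  moreover have "r\<^sup>2 < 1" using assms by (simp add: abs_square_less_1)
  ultimately have "(r * cos t)\<^sup>2 \<le> 1 - (r * sin t)\<^sup>2" by linarith
  then have "sqrt ((r * cos t)\<^sup>2) \<le> sqrt (1 - (r * sin t)\<^sup>2)" by (rule real_sqrt_le_mono)
  then show ?thesis using one_minus_sin_pos(2)[OF assms, of t]
    unfolding zigzag'_def by (simp add: abs_mult)
qed

lemma zigzag_tendsto:
  assumes "r \<longlonglongrightarrow> 1" "\<And>m. \<bar>r m\<bar> < 1"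
  shows "(\<lambda>m. zigzag (r m) t) \<longlonglongrightarrow> arcsin (sin t)"
proof -
  have 1: "(\<lambda>m. r m * sin t) \<longlonglongrightarrow> 1 * sin t" by (intro tendsto_intros assms)
  have "continuous_on {-1..1} arcsin" by (rule continuous_on_arcsin') 
  moreover have "r m * sin t \<in> {-1..1}" for m
    using one_minus_sin_pos(1)[OF assms(2), of m t] by (auto simp: abs_less_iff)
  ultimately show ?thesis
    unfolding zigzag_def using continuous_on_tendsto_compose[OF _ 1, of "{-1..1}" arcsin] by simp
qed

lemma zigzag'_tendsto:
  assumes "r \<longlonglongrightarrow> 1" "cos t \<noteq> 0"
  shows "(\<lambda>m. zigzag' (r m) t) \<longlonglongrightarrow> sgn (cos t)"
proof -
  have "1 - (1 * sin t)\<^sup>2 = (cos t)\<^sup>2" by (simp add: cos_squared_eq)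
  then have s: "sqrt (1 - (1 * sin t)\<^sup>2) = \<bar>cos t\<bar>" by simp
  have "(\<lambda>m. zigzag' (r m) t) \<longlonglongrightarrow> 1 * cos t / sqrt (1 - (1 * sin t)\<^sup>2)"
    unfolding zigzag'_def by (intro tendsto_intros assms) (use s assms in simp)
  also have "1 * cos t / sqrt (1 - (1 * sin t)\<^sup>2) = sgn (cos t)"
    unfolding s using assms(2) by (simp add: sgn_if)
  finally show ?thesis .
qed

subsection \<open>Integration by parts\<close>

lemma compact_support_bounded:
  fixes f :: "'a::euclidean_space \<Rightarrow> 'b::euclidean_space"
  assumes "continuous_on UNIV f" "compact K" "\<And>x. x \<notin> K \<Longrightarrow> f x = 0"
  obtains B where "B \<ge> 0" "\<And>x. norm (f x) \<le> B"
proof -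
  have "bounded (f ` K)"
    by (rule compact_imp_bounded[OF compact_continuous_image[OF
        continuous_on_subset[OF assms(1)] assms(2)]]) simp
  then obtain B where "\<And>x. x \<in> K \<Longrightarrow> norm (f x) \<le> B"
    by (auto simp: bounded_iff)
  then have "norm (f x) \<le> max B 0" for x
    using assms(3)[of x] by (cases "x \<in> K") (auto simp: le_max_iff_disj)
  then show ?thesis by (intro that[of "max B 0"]) auto
qed

lemma integrable_compact_support:
  fixes f :: "'a::euclidean_space \<Rightarrow> 'b::euclidean_space"
  assumes "continuous_on UNIV f" "compact K" "\<And>x. x \<notin> K \<Longrightarrow> f x = 0"
  shows "integrable lborel f"
proof -
  have "integrable lborel (\<lambda>x. indicator K x *\<^sub>R f x)"
    by (rule borel_integrable_compact) (use assms in \<open>auto intro: continuous_on_subset\<close>)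
  moreover have "(\<lambda>x. indicator K x *\<^sub>R f x) = f"
    using assms(3) by (auto simp: indicator_def)
  ultimately show ?thesis by simp
qed

lemma integral_translation:
  fixes f :: "'a::euclidean_space \<Rightarrow> real"
  assumes [measurable]: "f \<in> borel_measurable borel"
  shows "integral\<^sup>L lborel (\<lambda>x. f (x + c)) = integral\<^sup>L lborel f"
proof -
  have "integral\<^sup>L lborel f = integral\<^sup>L (distr lborel borel ((+) c)) f"
    by (simp add: lborel_distr_plus)
  also have "\<dots> = integral\<^sup>L lborel (\<lambda>x. f (c + x))"
    by (subst integral_distr) auto
  finally show ?thesis by (simp add: add.commute)
qed

lemma integrable_translation:
  fixes f :: "'a::euclidean_space \<Rightarrow> real"
  assumes "integrable lborel f"
  shows "integrable lborel (\<lambda>x. f (x + c))"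
proof -
  have "integrable (distr lborel borel ((+) c)) f"
    using assms by (simp add: lborel_distr_plus)
  then show ?thesis by (subst (asm) integrable_distr_eq) (use assms in \<open>auto simp: add.commute\<close>)
qed

section \<open>Difference quotients of compactly supported C^1 functions\<close>

definition C1_compact :: "('a::euclidean_space \<Rightarrow> real) \<Rightarrow> bool" where
  "C1_compact f \<longleftrightarrow> C_k 1 f \<and> (\<exists>K. compact K \<and> (\<forall>x. x \<notin> K \<longrightarrow> f x = 0))"

abbreviation pderiv_dir :: "('a::real_normed_vector \<Rightarrow> real) \<Rightarrow> 'a \<Rightarrow> 'a \<Rightarrow> real" where
  "pderiv_dir f b x \<equiv> frechet_derivative f (at x) b"

lemma frechet_derivative_zero_outside:
  assumes "closed K" "\<And>x. x \<notin> K \<Longrightarrow> f x = 0" "x \<notin> K"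
  shows "frechet_derivative f (at x) = (\<lambda>h. 0)"
proof -
  have "(f has_derivative (\<lambda>h. 0)) (at x)"
    by (rule has_derivative_transform_within_open[of "\<lambda>x. 0" _ _ _ "-K"]) (use assms in auto)
  then show ?thesis using frechet_derivative_at by metis
qed

lemma C1_compactD:
  assumes "C1_compact f" "b \<in> Basis"
  shows "continuous_on UNIV f" "continuous_on UNIV (pderiv_dir f b)"
    "integrable lborel f" "integrable lborel (pderiv_dir f b)"
    "(f has_derivative frechet_derivative f (at x)) (at x)"
proof -
  obtain K where K: "compact K" "\<And>x. x \<notin> K \<Longrightarrow> f x = 0" and C: "C_k (Suc 0) f" 
    using assms unfolding C1_compact_def by auto
  show 1: "continuous_on UNIV f" using C_k_SucD[OF C] by simp
  show 2: "continuous_on UNIV (pderiv_dir f b)" using C assms by simp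
  show "integrable lborel f" by (rule integrable_compact_support[OF 1 K])
  show "integrable lborel (pderiv_dir f b)"
    by (rule integrable_compact_support[OF 2 K(1)])
      (simp add: frechet_derivative_zero_outside[OF compact_imp_closed[OF K(1)] K(2)])
  show "(f has_derivative frechet_derivative f (at x)) (at x)"
    by (rule C_k_has_derivative[OF C])
qed

lemma line_derivative:
  assumes "\<And>x. (f has_derivative frechet_derivative f (at x)) (at x)"
  shows "((\<lambda>s. f (x + s *\<^sub>R b)) has_real_derivative pderiv_dir f b (x + s *\<^sub>R b)) (at s)"
proof -
  have "((\<lambda>s. x + s *\<^sub>R b) has_derivative (\<lambda>h. h *\<^sub>R b)) (at s)"
    by (auto intro!: derivative_eq_intros)
  from has_derivative_compose[OF this assms]
  show ?thesis
    using linear_scale[OF has_derivative_linear[OF assms]]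
    by (simp add: has_field_derivative_def mult.commute[of "pderiv_dir f b _"] mult_commute_abs)
qed

text \<open>Mean value inequality along a line; the bound is uniform in the base point because the
  directional derivative is continuous with compact support.\<close>

lemma C1_compact_difference_bound:
  assumes "C1_compact f" "b \<in> Basis"
  obtains B where "B \<ge> 0" "\<And>x h. \<bar>f (x + h *\<^sub>R b) - f x\<bar> \<le> B * \<bar>h\<bar>"
proof -
  obtain K where K: "compact K" "\<And>x. x \<notin> K \<Longrightarrow> f x = 0" using assms unfolding C1_compact_def by auto
  have "pderiv_dir f b x = 0" if "x \<notin> K" for x
    using frechet_derivative_zero_outside[OF compact_imp_closed[OF K(1)] K(2) that] by simp
  then obtain B where B: "B \<ge> 0" "\<And>x. norm (pderiv_dir f b x) \<le> B"
    using compact_support_bounded[OF C1_compactD(2)[OF assms] K(1)] by auto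
  have "norm (f (x + h *\<^sub>R b) - f (x + 0 *\<^sub>R b)) \<le> B * norm (h - 0)" for x h
    by (rule field_differentiable_bound[of UNIV "\<lambda>s. f (x + s *\<^sub>R b)"])
      (use line_derivative[OF C1_compactD(5)[OF assms], of x b] B in auto)
  then show ?thesis using B by (intro that[of B]) auto
qed

text \<open>The step 1/(n + 1) is never zero and keeps translates within distance 1. Both directions
  occur because moving a translation from one factor of a product to the other reverses its
  sign.\<close>

definition forward_quotient :: "('a::real_normed_vector \<Rightarrow> real) \<Rightarrow> 'a \<Rightarrow> nat \<Rightarrow> 'a \<Rightarrow> real" where
  "forward_quotient f b n x = (f (x + inverse (real (Suc n)) *\<^sub>R b) - f x) / inverse (real (Suc n))"

definition backward_quotient :: "('a::real_normed_vector \<Rightarrow> real) \<Rightarrow> 'a \<Rightarrow> nat \<Rightarrow> 'a \<Rightarrow> real" where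
  "backward_quotient f b n x = (f (x + (- inverse (real (Suc n))) *\<^sub>R b) - f x) / (- inverse (real
      (Suc n)))"

lemma difference_quotient_tendsto:
  assumes "\<And>x. (f has_derivative frechet_derivative f (at x)) (at x)"
  shows "(\<lambda>n. forward_quotient f b n x) \<longlonglongrightarrow> pderiv_dir f b x"
    "(\<lambda>n. backward_quotient f b n x) \<longlonglongrightarrow> pderiv_dir f b x"
proof -
  have 1: "((\<lambda>h. (f (x + h *\<^sub>R b) - f x) / h) \<longlongrightarrow> pderiv_dir f b x) (at 0)"
    using line_derivative[OF assms, of x b 0] by (simp add: DERIV_def)
  have 2: "filterlim (\<lambda>n. inverse (real (Suc n))) (at 0) sequentially"
    unfolding filterlim_at using LIMSEQ_inverse_real_of_nat by auto
  have 3: "filterlim (\<lambda>n. - inverse (real (Suc n))) (at 0) sequentially"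
    unfolding filterlim_at using tendsto_minus[OF LIMSEQ_inverse_real_of_nat] by auto
  show "(\<lambda>n. forward_quotient f b n x) \<longlonglongrightarrow> pderiv_dir f b x" "(\<lambda>n. backward_quotient f b n x)
      \<longlonglongrightarrow> pderiv_dir f b x"
    unfolding forward_quotient_def backward_quotient_def
        using filterlim_compose[OF 1 2] filterlim_compose[OF 1 3] by auto
qed

lemma difference_quotient_bound:
  assumes "C1_compact f" "b \<in> Basis"
  obtains B where "B \<ge> 0" "\<And>n x. \<bar>forward_quotient f b n x\<bar> \<le> B" "\<And>n x. \<bar>backward_quotient f b n x\<bar> \<le> B"
proof -
  obtain B where B: "B \<ge> 0" "\<And>x h. \<bar>f (x + h *\<^sub>R b) - f x\<bar> \<le> B * \<bar>h\<bar>"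
    using C1_compact_difference_bound[OF assms] by metis
  show ?thesis
  proof (rule that[OF B(1)])
    show "\<bar>forward_quotient f b n x\<bar> \<le> B" for n x
      unfolding forward_quotient_def abs_divide by (subst pos_divide_le_eq) (use B(2)[of x "inverse (real
          (Suc n))"] in auto)
    show "\<bar>backward_quotient f b n x\<bar> \<le> B" for n x
      unfolding backward_quotient_def abs_divide by (subst pos_divide_le_eq) (use B(2)[of x "- inverse
          (real (Suc n))"] in auto)
  qed
qed

text \<open>Steps of length at most 1 enlarge a support by at most 1, so one ball serves all
  \<open>n\<close> and all \<open>f\<close> supported in \<open>K\<close>. It carries the dominating
  function in the limits below.\<close>

lemma difference_quotient_support:
  assumes "compact K" "b \<in> Basis"
  obtains L where "compact L" "K \<subseteq> L"
    "\<And>(f::'a::euclidean_space \<Rightarrow> real) n x. (\<And>x. x \<notin> K \<Longrightarrow> f x = 0) \<Longrightarrow> x \<notin> L \<Longrightarrow> forward_quotient f b n x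
        = 0 \<and> backward_quotient f b n x = 0"
proof -
  obtain r where r: "\<And>x. x \<in> K \<Longrightarrow> norm x \<le> r"
    using compact_imp_bounded[OF assms(1)] by (auto simp: bounded_iff)
  show ?thesis
  proof (rule that[of "cball 0 (r + 1)"])
    show "K \<subseteq> cball 0 (r + 1)" using r by force
    fix f :: "'a \<Rightarrow> real" and n and x :: 'a
    assume f: "\<And>x. x \<notin> K \<Longrightarrow> f x = 0" and x: "x \<notin> cball 0 (r + 1)"
    have "x + h *\<^sub>R b \<notin> K" if "\<bar>h\<bar> \<le> 1" for h
      using norm_triangle_ineq4[of "x + h *\<^sub>R b" "h *\<^sub>R b"] that assms r[of "x + h *\<^sub>R b"] x by auto
    from this[of "inverse (real (Suc n))"] this[of "- inverse (real (Suc n))"] this[of 0]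
    have "x + inverse (real (Suc n)) *\<^sub>R b \<notin> K" "x + (- inverse (real (Suc n))) *\<^sub>R b \<notin> K" "x \<notin> K"
      by (simp_all add: inverse_le_1_iff)
    then show "forward_quotient f b n x = 0 \<and> backward_quotient f b n x = 0"
      unfolding forward_quotient_def backward_quotient_def using f by simp
  qed simp
qed

text \<open>Translation invariance makes every forward quotient integrate to zero, and dominated
  convergence passes this on to the derivative.\<close>

lemma integral_pderiv_dir_zero:
  assumes f: "C1_compact f" "b \<in> Basis"
  shows "integral\<^sup>L lborel (pderiv_dir f b) = 0"
proof -
  note D = C1_compactD[OF f]
  note [measurable] = borel_measurable_continuous_onI[OF D(1)] borel_measurable_continuous_onI[OF D(2)]
  obtain K where K: "compact K" "\<And>x. x \<notin> K \<Longrightarrow> f x = 0" using f unfolding C1_compact_def by auto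
  obtain B where B: "B \<ge> 0" "\<And>n x. \<bar>forward_quotient f b n x\<bar> \<le> B" using difference_quotient_bound[OF f]
      by metis
  obtain L where L: "compact L" "\<And>n x. x \<notin> L \<Longrightarrow> forward_quotient f b n x = 0"
    using difference_quotient_support[OF K(1) f(2)] K(2) by metis
  have "(\<lambda>n. integral\<^sup>L lborel (forward_quotient f b n)) \<longlonglongrightarrow> integral\<^sup>L lborel (pderiv_dir f b)"
  proof (rule integral_dominated_convergence)
    show "integrable lborel (\<lambda>x. B * indicator L x)"
      using L(1) emeasure_compact_finite[OF L(1)]
        by (intro integrable_mult_right integrable_real_indicator) (auto simp: compact_imp_closed)
    show "AE x in lborel. norm (forward_quotient f b n x) \<le> B * indicator L x" for n
      using B L(2) by (auto simp: indicator_def)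
    show "AE x in lborel. (\<lambda>n. forward_quotient f b n x) \<longlonglongrightarrow> pderiv_dir f b x"
      using difference_quotient_tendsto[OF D(5)] by auto
    show "forward_quotient f b n \<in> borel_measurable lborel" for n unfolding forward_quotient_def
        by measurable
  qed measurable
  moreover have "integral\<^sup>L lborel (forward_quotient f b n) = 0" for n
    unfolding forward_quotient_def
    using D(3) integrable_translation[OF D(3)] by (simp add: integral_translation)
  ultimately show ?thesis by (simp add: LIMSEQ_const_iff)
qed

text \<open>Moving the two translations from one factor to the other replaces the symmetry of second
  derivatives in the proof that Jacobian determinants have vanishing integral.\<close>

lemma integral_difference_quotient_exchange:
  assumes f: "C1_compact f" "C1_compact q" and b: "a \<in> Basis" "b \<in> Basis"
  shows "integral\<^sup>L lborel (\<lambda>x. forward_quotient f a n x * forward_quotient q b n x)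
    = integral\<^sup>L lborel (\<lambda>x. backward_quotient f b n x * backward_quotient q a n x)"
proof -
  define h where "h = inverse (real (Suc n))"
  have h: "h \<noteq> 0" by (simp add: h_def)
  note cf = C1_compactD(1)[OF f(1) b(1)] and cq = C1_compactD(1)[OF f(2) b(1)]
  obtain K where K: "compact K" "\<And>x. x \<notin> K \<Longrightarrow> f x = 0" using f unfolding C1_compact_def by auto
  have ct: "continuous_on UNIV (\<lambda>x. u (x + c))" if "continuous_on UNIV u" for u :: "'a \<Rightarrow> real" and c
    by (rule continuous_on_compose2[OF that]) (auto intro: continuous_intros)
  have i0: "integrable lborel (\<lambda>x. f x * q (x + d))" for d
    by (rule integrable_compact_support[OF _ K(1)]) (use K cf ct[OF cq] in \<open>auto intro!: continuous_intros\<close>)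
  have I: "integrable lborel (\<lambda>x. f (x + c) * q (x + d))" for c d
    using integrable_translation[OF i0[of "d - c"], of c] by simp
  have M: "(\<lambda>x. f (x + c) * q (x + d)) \<in> borel_measurable borel" for c d
    using I[of c d] by (auto dest: borel_measurable_integrable)
  have T: "integral\<^sup>L lborel (\<lambda>x. f (x + c) * q (x + d)) = integral\<^sup>L lborel (\<lambda>x. f (x + (c + e)) * q (x +
      (d + e)))" for c d e
    using integral_translation[OF M[of c d], of e] by (simp add: ac_simps)
  have 1: "(\<lambda>x. forward_quotient f a n x * forward_quotient q b n x) = (\<lambda>x. inverse (h^2) *
     (f (x + h *\<^sub>R a) * q (x + h *\<^sub>R b) - f (x + h *\<^sub>R a) * q (x + 0) - f (x + 0) * q (x + h *\<^sub>R b) + f (x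
         + 0) * q (x + 0)))"
    unfolding forward_quotient_def h_def[symmetric] using h by (auto simp: field_simps power2_eq_square)
  have 2: "(\<lambda>x. backward_quotient f b n x * backward_quotient q a n x) = (\<lambda>x. inverse (h^2) *
     (f (x + (-h) *\<^sub>R b) * q (x + (-h) *\<^sub>R a) - f (x + (-h) *\<^sub>R b) * q (x + 0) - f (x + 0) * q (x + (-h)
         *\<^sub>R a) + f (x + 0) * q (x + 0)))"
    unfolding backward_quotient_def h_def[symmetric] using h by (auto simp: field_simps power2_eq_square)
  have t1: "integral\<^sup>L lborel (\<lambda>x. f (x + (-h) *\<^sub>R b) * q (x + (-h) *\<^sub>R a)) = integral\<^sup>L lborel (\<lambda>x. f (x
      + h *\<^sub>R a) * q (x + h *\<^sub>R b))"
    by (subst T[where e="h *\<^sub>R a + h *\<^sub>R b"]) simp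
  have t2: "integral\<^sup>L lborel (\<lambda>x. f (x + (-h) *\<^sub>R b) * q (x + 0)) = integral\<^sup>L lborel (\<lambda>x. f (x + 0) * q
      (x + h *\<^sub>R b))"
    by (subst T[where e="h *\<^sub>R b"]) simp
  have t3: "integral\<^sup>L lborel (\<lambda>x. f (x + 0) * q (x + (-h) *\<^sub>R a)) = integral\<^sup>L lborel (\<lambda>x. f (x + h
      *\<^sub>R a) * q (x + 0))"
    by (subst T[where e="h *\<^sub>R a"]) simp
  show ?thesis
    unfolding 1 2 
    by (simp only: I t1 t2 t3 Bochner_Integration.integral_add Bochner_Integration.integral_diff
        Bochner_Integration.integrable_add Bochner_Integration.integrable_diff Bochner_Integration.integral_mult_right_zero) simp
qed

text \<open>Both sides are limits of integrals of products of difference quotients, forward on the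
  left and backward on the right, and these integrals agree for every \<open>n\<close>. No second
  derivatives appear.\<close>

lemma integral_pderiv_exchange:
  assumes f: "C1_compact f" "C1_compact q" and b: "a \<in> Basis" "b \<in> Basis"
  shows "integral\<^sup>L lborel (\<lambda>x. pderiv_dir f a x * pderiv_dir q b x)
    = integral\<^sup>L lborel (\<lambda>x. pderiv_dir f b x * pderiv_dir q a x)"
proof -
  have lim: "(\<lambda>n. integral\<^sup>L lborel (\<lambda>x. forward_quotient u c n x * forward_quotient v d n x)) \<longlonglongrightarrow>
      integral\<^sup>L lborel (\<lambda>x. pderiv_dir u c x * pderiv_dir v d x)
    \<and> (\<lambda>n. integral\<^sup>L lborel (\<lambda>x. backward_quotient u c n x * backward_quotient v d n x)) \<longlonglongrightarrow>
        integral\<^sup>L lborel (\<lambda>x. pderiv_dir u c x * pderiv_dir v d x)"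
    if u: "C1_compact u" "C1_compact v" "c \<in> Basis" "d \<in> Basis" for u v :: "'a \<Rightarrow> real" and c d
  proof -
    note D = C1_compactD[OF u(1,3)] and E = C1_compactD[OF u(2,4)]
    note [measurable] = borel_measurable_continuous_onI[OF D(1)] borel_measurable_continuous_onI[OF D(2)]
      borel_measurable_continuous_onI[OF E(1)] borel_measurable_continuous_onI[OF E(2)]
    obtain K where K: "compact K" "\<And>x. x \<notin> K \<Longrightarrow> u x = 0" using u unfolding C1_compact_def by auto
    obtain B where B: "B \<ge> 0" "\<And>n x. \<bar>forward_quotient u c n x\<bar> \<le> B" "\<And>n x. \<bar>backward_quotient u c n x\<bar>
        \<le> B" using difference_quotient_bound[OF u(1,3)] by metis
    obtain B' where B': "B' \<ge> 0" "\<And>n x. \<bar>forward_quotient v d n x\<bar> \<le> B'"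
        "\<And>n x. \<bar>backward_quotient v d n x\<bar> \<le> B'" using difference_quotient_bound[OF u(2,4)] by metis
    obtain L where L: "compact L" "\<And>n x. x \<notin> L \<Longrightarrow> forward_quotient u c n x = 0 \<and> backward_quotient u c n x
        = 0"
      using difference_quotient_support[OF K(1) u(3)] K(2) by metis
    have i: "integrable lborel (\<lambda>x. B * B' * indicator L x)"
      using L(1) emeasure_compact_finite[OF L(1)]
        by (intro integrable_mult_right integrable_real_indicator) (auto simp: compact_imp_closed)
    show ?thesis
    proof (intro conjI; rule integral_dominated_convergence[OF _ _ i])
      show "AE x in lborel. norm (forward_quotient u c n x * forward_quotient v d n x) \<le> B * B'
          * indicator L x" for n
        using B B' L(2) by (auto simp: indicator_def abs_mult intro!: mult_mono)
      show "AE x in lborel. norm (backward_quotient u c n x * backward_quotient v d n x) \<le> B * B'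
          * indicator L x" for n
        using B B' L(2) by (auto simp: indicator_def abs_mult intro!: mult_mono)
      show "AE x in lborel. (\<lambda>n. forward_quotient u c n x * forward_quotient v d n x) \<longlonglongrightarrow> pderiv_dir u c x
          * pderiv_dir v d x"
        using difference_quotient_tendsto[OF D(5)] difference_quotient_tendsto[OF E(5)] by
            (auto intro!: tendsto_mult)
      show "AE x in lborel. (\<lambda>n. backward_quotient u c n x * backward_quotient v d n x) \<longlonglongrightarrow> pderiv_dir u c x
          * pderiv_dir v d x"
        using difference_quotient_tendsto[OF D(5)] difference_quotient_tendsto[OF E(5)] by
            (auto intro!: tendsto_mult)
      show "(\<lambda>x. forward_quotient u c n x * forward_quotient v d n x) \<in> borel_measurable lborel"
          for n unfolding forward_quotient_def by measurable
      show "(\<lambda>x. backward_quotient u c n x * backward_quotient v d n x) \<in> borel_measurable lborel"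
          for n unfolding backward_quotient_def by measurable
    qed measurable
  qed
  show ?thesis
    using lim[OF f b] lim[OF f b(2,1)] integral_difference_quotient_exchange[OF f b]
    by (metis (no_types, lifting) LIMSEQ_unique ext)
qed

subsection \<open>The fundamental lemma and uniqueness of weak derivatives\<close>

lemma test_functionsE:
  assumes "\<psi> \<in> test_functions \<Omega>"
  obtains K where "compact K" "K \<subseteq> \<Omega>" "\<And>x. x \<notin> K \<Longrightarrow> \<psi> x = 0"
  using assms closure_subset[of "{x. \<psi> x \<noteq> 0}"] that[of "closure {x. \<psi> x \<noteq> 0}"]
  unfolding test_functions_def by blast

lemma test_functionsI:
  assumes "\<And>n. C_k n \<psi>" "compact K" "K \<subseteq> \<Omega>" "\<And>x. x \<notin> K \<Longrightarrow> \<psi> x = 0"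
  shows "\<psi> \<in> test_functions \<Omega>"
proof -
  have "closure {x. \<psi> x \<noteq> 0} \<subseteq> K"
    by (rule closure_minimal) (use assms compact_imp_closed in auto)
  moreover from this have "compact (closure {x. \<psi> x \<noteq> 0})"
    using assms(2) compact_closure bounded_subset[OF compact_imp_bounded[OF assms(2)]] closed_closure
    by (meson compact_eq_bounded_closed)
  ultimately show ?thesis using assms unfolding test_functions_def by auto
qed

text \<open>Open boxes are closed under intersection and generate the Borel sets, so vanishing
  integrals over boxes spread to all Borel sets, and a density with only zero integrals is
  zero.\<close>

lemma AE_zero_of_box_integrals:
  fixes f :: "'a::euclidean_space \<Rightarrow> real"
  assumes f: "integrable lebesgue f" "integral\<^sup>L lebesgue f = 0"
    and box: "\<And>a b. integral\<^sup>L lebesgue (\<lambda>x. indicator (box a b) x * f x) = 0"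
  shows "AE x in lebesgue. f x = 0"
proof -
  \<comment> \<open>The induction runs over Borel sets while \<open>f\<close> is merely Lebesgue
    measurable, so a Borel version \<open>p\<close> takes its place.\<close>
  obtain p where p[measurable]: "p \<in> borel_measurable lborel" and fp: "AE x in lborel. f x = p x"
    using completion_ex_borel_measurable_real[OF borel_measurable_integrable[OF f(1)]] by auto
  have fm[measurable]: "f \<in> borel_measurable lebesgue" using f(1) by auto
  have pm: "p \<in> borel_measurable lebesgue" using measurable_completion[OF p] .
  have "integrable lebesgue p"
    by (rule integrable_cong_AE_imp[OF f(1) pm AE_completion[OF fp]])
  then have ip: "integrable lborel p" using integrable_completion[OF p] by simp
  have eq: "integral\<^sup>L lebesgue (\<lambda>x. indicator A x * f x) = set_lebesgue_integral lborel A p"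
    if [measurable]: "A \<in> sets borel" for A
  proof -
    have "integral\<^sup>L lebesgue (\<lambda>x. indicator A x * f x) = integral\<^sup>L lebesgue (\<lambda>x. indicator A x * p x)"
    proof (rule integral_cong_AE)
      show "AE x in lebesgue. indicator A x * f x = indicator A x * p x"
        using AE_completion[OF fp] by eventually_elim simp
    qed (use that pm fm in \<open>auto intro!: borel_measurable_times borel_measurable_indicator\<close>)
    also have "\<dots> = set_lebesgue_integral lborel A p"
      unfolding set_lebesgue_integral_def by (subst integral_completion) auto
    finally show ?thesis .
  qed
  have si: "set_integrable lborel A p" if "A \<in> sets borel" for A
    unfolding set_integrable_def using ip that by (intro integrable_mult_indicator) auto
  have "AE x in lborel. p x = 0"
  proof (rule sigma_finite_measure.density_zero[OF sigma_finite_lborel ip])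
    fix A :: "'a set" assume "A \<in> sets lborel"
    have st: "Int_stable (range (\<lambda>(a, b). box a b :: 'a set))"
      by (auto simp: Int_stable_def box_Int_box)
    have sub: "range (\<lambda>(a, b). box a b :: 'a set) \<subseteq> Pow UNIV" by auto
    have "A \<in> sigma_sets UNIV (range (\<lambda>(a, b). box a b :: 'a set))"
      using \<open>A \<in> _\<close> by (simp add: borel_eq_box)
    with st sub show "set_lebesgue_integral lborel A p = 0"
    proof (induction rule: sigma_sets_induct_disjoint)
      case (basic A)
      then show ?case using eq box by auto
    next
      case (compl A)
      then have A: "A \<in> sets borel" by (simp add: borel_eq_box)
      \<comment> \<open>The complement case is where the vanishing of the total integral
        enters.\<close>
      have "set_lebesgue_integral lborel UNIV p = 0"
        using eq[of UNIV] f(2) by simp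
      moreover have "set_lebesgue_integral lborel (A \<union> (UNIV - A)) p =
          set_lebesgue_integral lborel A p + set_lebesgue_integral lborel (UNIV - A) p"
        by (rule set_integral_Un) (use si A in auto)
      ultimately show ?case using compl by simp
    next
      case (union A)
      then have A: "\<And>i. A i \<in> sets borel" by (auto simp: borel_eq_box)
      have "set_lebesgue_integral lborel (\<Union>i. A i) p = (\<Sum>i. set_lebesgue_integral lborel (A i) p)"
        by (rule lebesgue_integral_countable_add)
          (use A si union(1) in \<open>auto simp: disjoint_family_on_def\<close>)
      then show ?case using union by simp
    qed (auto simp: set_lebesgue_integral_def)
  qed
  with fp have "AE x in lborel. f x = 0" by eventually_elim simp
  then show ?thesis by (rule AE_completion)
qed

text \<open>A smooth function that is positive exactly on the open box and tends to its indicator as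
  \<open>n\<close> grows. The limit feeds the fundamental lemma; the member \<open>n = 0\<close>
  later localises the oscillating maps.\<close>

definition box_bump :: "real^2 \<Rightarrow> real^2 \<Rightarrow> nat \<Rightarrow> real^2 \<Rightarrow> real" where
  "box_bump a b n x =
     (exp_cutoff 0 (real (Suc n) * (x$1 - a$1)) * exp_cutoff 0 (real (Suc n) * (b$1 - x$1))) *
     (exp_cutoff 0 (real (Suc n) * (x$2 - a$2)) * exp_cutoff 0 (real (Suc n) * (b$2 - x$2)))"

lemma C_k_box_bump: "C_k m (box_bump a b n)"
proof -
  have 1: "C_k m (\<lambda>x::real^2. c * (x $ i - d))" for c d i
    using C_k_mult[OF C_k_const C_k_add[OF C_k_nth C_k_const[of m "-d"]], of c] by simp
  have 2: "C_k m (\<lambda>x::real^2. c * (d - x $ i))" for c d i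
    using 1[of "-c" i d] by (simp add: algebra_simps)
  show ?thesis
    unfolding box_bump_def by (intro C_k_mult C_k_compose[OF C_k_exp_cutoff] 1 2)
qed

lemma box_bump_bounds: "0 \<le> box_bump a b n x" "box_bump a b n x \<le> 1"
  unfolding box_bump_def
  by (auto intro!: mult_nonneg_nonneg mult_le_one exp_cutoff_bounds)

lemma mem_box_2: "x \<in> box a b \<longleftrightarrow> a$1 < x$1 \<and> x$1 < b$1 \<and> a$2 < x$2 \<and> x$2 < (b::real^2)$2"
  by (auto simp: mem_box_cart forall_2)

lemma box_bump_eq_0: "x \<notin> box a b \<Longrightarrow> box_bump a b n x = 0"
  unfolding box_bump_def mem_box_2
  by (auto simp: exp_cutoff_def zero_less_mult_iff simp del: of_nat_Suc)

lemma box_bump_pos: "x \<in> box a b \<Longrightarrow> 0 < box_bump a b n x"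
  unfolding box_bump_def mem_box_2
  by (auto simp: exp_cutoff_def simp del: of_nat_Suc intro!: mult_pos_pos)

lemma box_bump_tendsto: "(\<lambda>n. box_bump a b n x) \<longlonglongrightarrow> indicator (box a b) x"
proof -
  have "(\<lambda>n. box_bump a b n x) \<longlonglongrightarrow>
    ((if x$1 - a$1 > 0 then 1 else 0) * (if b$1 - x$1 > 0 then 1 else 0::real)) *
    ((if x$2 - a$2 > 0 then 1 else 0) * (if b$2 - x$2 > 0 then 1 else 0))"
    unfolding box_bump_def by (intro tendsto_mult exp_cutoff_scaled_tendsto)
  then show ?thesis by (rule back_subst[of "\<lambda>l. _ \<longlonglongrightarrow> l"]) (auto simp: indicator_def mem_box_2)
qed

lemma box_bump_test_function:
  assumes "cbox a b \<subseteq> \<Omega>" shows "box_bump a b n \<in> test_functions \<Omega>"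
  by (rule test_functionsI[OF C_k_box_bump compact_cbox assms])
    (use box_subset_cbox box_bump_eq_0 in blast)

lemma integral_lebesgue_on_restrict:
  fixes f :: "'a::euclidean_space \<Rightarrow> real"
  assumes "open \<Omega>"
  shows "integral\<^sup>L (lebesgue_on \<Omega>) f = integral\<^sup>L lebesgue (\<lambda>x. indicator \<Omega> x * f x)"
  using assms by (subst integral_restrict_space) auto

text \<open>Bumps tending to the indicator of an open box show that \<open>F\<close> has zero
  integral over it whenever the closed box lies in \<Omega>. This forces \<open>F\<close> to vanish
  almost everywhere on each such box, and countably many of them cover \<Omega>.\<close>

lemma fundamental_lemma:
  fixes F :: "real^2 \<Rightarrow> real"
  assumes \<Omega>: "open \<Omega>" and F: "locally_integrable \<Omega> F"
    and 0: "\<And>\<psi>. \<psi> \<in> test_functions \<Omega> \<Longrightarrow> integral\<^sup>L (lebesgue_on \<Omega>) (\<lambda>x. F x * \<psi> x) = 0"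
  shows "AE x in lebesgue_on \<Omega>. F x = 0"
proof -
  have int: "integrable lebesgue (\<lambda>x. indicator (cbox a b) x * F x)" if "cbox a b \<subseteq> \<Omega>" for a b
  proof -
    have "integrable (lebesgue_on (cbox a b)) F" using F that unfolding locally_integrable_def by simp
    then show ?thesis by (subst (asm) integrable_restrict_space) auto
  qed
  have box0: "integral\<^sup>L lebesgue (\<lambda>x. indicator (box a b) x * F x) = 0" if "cbox a b \<subseteq> \<Omega>" for a b
  proof -
    have "(\<lambda>n. integral\<^sup>L lebesgue (\<lambda>x. box_bump a b n x * (indicator (cbox a b) x * F x))) \<longlonglongrightarrow>
        integral\<^sup>L lebesgue (\<lambda>x. indicator (box a b) x * (indicator (cbox a b) x * F x))"
    proof (rule integral_dominated_convergence)
      have m: "box_bump a b n \<in> borel_measurable lborel" for n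
        using C_k_box_bump[of 0] by (simp add: borel_measurable_continuous_onI)
      show "(\<lambda>x. box_bump a b n x * (indicator (cbox a b) x * F x)) \<in> borel_measurable lebesgue" for n
        by (rule borel_measurable_times[OF measurable_completion[OF m] borel_measurable_integrable[OF int[OF that]]])
      show "(\<lambda>x. indicator (box a b) x * (indicator (cbox a b) x * F x)) \<in> borel_measurable lebesgue"
        by  (rule borel_measurable_times[OF measurable_completion borel_measurable_integrable[OF int[OF that]]]) simp
      show "integrable lebesgue (\<lambda>x. \<bar>indicator (cbox a b) x * F x\<bar>)"
        using int[OF that] by (rule integrable_abs)
      show "AE x in lebesgue. (\<lambda>n. box_bump a b n x * (indicator (cbox a b) x * F x)) \<longlonglongrightarrow> 
          indicator (box a b) x * (indicator (cbox a b) x * F x)"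
        by (intro AE_I2 tendsto_mult box_bump_tendsto tendsto_const)
      show "AE x in lebesgue. norm (box_bump a b n x * (indicator (cbox a b) x * F x)) \<le> \<bar>indicator
          (cbox a b) x * F x\<bar>" for n
        using box_bump_bounds[of a b n]
        by (intro AE_I2) (simp only: real_norm_def abs_mult[of
            "box_bump a b n _"], rule mult_left_le_one_le, auto)
    qed
    moreover have "(\<lambda>x. box_bump a b n x * (indicator (cbox a b) x * F x)) = (\<lambda>x. indicator \<Omega> x * (F x
        * box_bump a b n x))" for n
      using that box_bump_eq_0[of _ a b n] box_subset_cbox[of a b] by (force simp: indicator_def)
    moreover have "(\<lambda>x. indicator (box a b) x * (indicator (cbox a b) x * F x)) = (\<lambda>x. indicator
        (box a b) x * F x)"
      using box_subset_cbox[of a b] by (intro ext) (auto simp: indicator_def)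
    moreover have "integral\<^sup>L lebesgue (\<lambda>x. indicator \<Omega> x * (F x * box_bump a b n x)) = 0" for n
      using 0[OF box_bump_test_function[OF that]] by (simp add: integral_lebesgue_on_restrict[OF \<Omega>])
    ultimately show ?thesis by (simp add: LIMSEQ_const_iff)
  qed
  have *: "AE x in lebesgue. x \<in> cbox c d \<longrightarrow> F x = 0" if cd: "cbox c d \<subseteq> \<Omega>" for c d
  proof -
    have "integrable lebesgue (\<lambda>x. indicator (box c d) x *\<^sub>R (indicator (cbox c d) x * F x))"
      by (rule integrable_mult_indicator) (use int[OF cd] in auto)
    moreover have "(\<lambda>x. indicator (box c d) x *\<^sub>R (indicator (cbox c d) x * F x)) = (\<lambda>x. indicator
        (box c d) x * F x)"
      using box_subset_cbox[of c d] by (intro ext) (auto simp: indicator_def)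
    ultimately have I: "integrable lebesgue (\<lambda>x. indicator (box c d) x * F x)" by simp
    \<comment> \<open>Localising to an open box is convenient because its intersection with any
      other open box is again an open box, to which \<open>box0\<close> applies.\<close>
    have "AE x in lebesgue. indicator (box c d) x * F x = 0"
    proof (rule AE_zero_of_box_integrals[OF I box0[OF cd]])
      fix a b :: "real^2"
      have "(\<lambda>x. indicator (box a b) x * (indicator (box c d) x * F x)) = (\<lambda>x. indicator
          (box a b \<inter> box c d) x * F x)"
        by (auto simp: indicator_def)
      moreover have "integral\<^sup>L lebesgue (\<lambda>x. indicator (box a b \<inter> box c d) x * F x) = 0"
        unfolding box_Int_box
        by (rule box0) (use cd in \<open>simp flip: Int_interval add: le_infI2\<close>)
      ultimately show "integral\<^sup>L lebesgue (\<lambda>x. indicator (box a b) x * (indicator (box c d) x * F x)) = 0"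
        by simp
    qed
    moreover have "AE x in lebesgue. x \<notin> cbox c d - box c d"
      by (rule AE_not_in) (use negligible_frontier_interval in \<open>simp add: negligible_iff_null_sets\<close>)
    ultimately show ?thesis by eventually_elim (auto simp: indicator_def split: if_splits)
  qed
  obtain D where D: "countable D" "D \<subseteq> Pow \<Omega>" "\<And>X. X \<in> D \<Longrightarrow> \<exists>a b. X = cbox a b" "\<Union>D = \<Omega>"
    using open_countable_Union_open_cbox[OF \<Omega>] by metis
  have "AE x in lebesgue. \<forall>X\<in>D. x \<in> X \<longrightarrow> F x = 0"
    unfolding AE_ball_countable[OF D(1)] using D(2,3) * by blast
  then have "AE x in lebesgue. x \<in> \<Omega> \<longrightarrow> F x = 0"
    by eventually_elim (use D(4) in auto)
  then show ?thesis using \<Omega> by (subst AE_restrict_space_iff) auto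
qed

section \<open>Weak Jacobians: uniqueness and linearity\<close>

lemma locally_integrable_bounded_linear:
  assumes "bounded_linear T" "locally_integrable \<Omega> u"
  shows "locally_integrable \<Omega> (\<lambda>x. T (u x))"
  using assms(2) unfolding locally_integrable_def by (auto intro: integrable_bounded_linear[OF assms(1)])

lemma integrable_mult_compact_support:
  fixes F p :: "real^2 \<Rightarrow> real"
  assumes \<Omega>: "open \<Omega>" and F: "locally_integrable \<Omega> F"
    and p: "continuous_on UNIV p" "compact K" "K \<subseteq> \<Omega>" "\<And>x. x \<notin> K \<Longrightarrow> p x = 0"
  shows "integrable (lebesgue_on \<Omega>) (\<lambda>x. F x * p x)"
proof -
  obtain B where B: "B \<ge> 0" "\<And>x. norm (p x) \<le> B" using compact_support_bounded[OF p(1,2,4)] by metis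
  have K: "K \<in> sets borel" using p(2) by (simp add: compact_imp_closed)
  have I: "integrable lebesgue (\<lambda>x. indicator K x * F x)"
  proof -
    have "integrable (lebesgue_on K) F" using F p unfolding locally_integrable_def by simp
    then show ?thesis by (subst (asm) integrable_restrict_space) (use K in auto)
  qed
  have m: "p \<in> borel_measurable lborel" using p(1) by (simp add: borel_measurable_continuous_onI)
  have "integrable lebesgue (\<lambda>x. p x * (indicator K x * F x))"
  proof (rule Bochner_Integration.integrable_bound[OF integrable_mult_right[OF I, of B]])
    show "(\<lambda>x. p x * (indicator K x * F x)) \<in> borel_measurable lebesgue"
by (rule borel_measurable_times[OF measurable_completion[OF m] borel_measurable_integrable[OF I]])
    show "AE x in lebesgue. norm (p x * (indicator K x * F x)) \<le> norm (B * (indicator K x * F x))"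
      using B by (intro AE_I2) (simp only: norm_mult[of "p _"] norm_mult[of B], intro mult_right_mono, auto)
  qed
  moreover have "(\<lambda>x. p x * (indicator K x * F x)) = (\<lambda>x. indicator \<Omega> x *\<^sub>R (F x * p x))"
    using p(3,4) by (force simp: indicator_def)
  ultimately show ?thesis using \<Omega> by (subst integrable_restrict_space) auto
qed

lemma locally_integrable_nth:
  fixes u :: "real^2 \<Rightarrow> (real^'n)" assumes "locally_integrable \<Omega> u"
  shows "locally_integrable \<Omega> (\<lambda>x. u x $ i)"
  using locally_integrable_bounded_linear[OF bounded_linear_vec_nth assms] .

lemma locally_integrable_nth2:
  fixes G :: "real^2 \<Rightarrow> (real^2^2)" assumes "locally_integrable \<Omega> G"
  shows "locally_integrable \<Omega> (\<lambda>x. G x $ i $ j)"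
  using locally_integrable_bounded_linear[OF bounded_linear_compose[OF bounded_linear_vec_nth bounded_linear_vec_nth] assms] .

text \<open>Each entry of G - H is orthogonal to all test functions, because both sides equal the
  same integral of \<open>u\<close> against a derivative. This makes energies independent of the
  choice inside \<open>weak_jacobian\<close>.\<close>

lemma weak_jacobian_unique:
  assumes \<Omega>: "open \<Omega>" and G: "has_weak_jacobian \<Omega> u G" and H: "has_weak_jacobian \<Omega> u H"
  shows "AE x in lebesgue_on \<Omega>. G x = H x"
proof -
  have li: "locally_integrable \<Omega> G" "locally_integrable \<Omega> H"
    using G H unfolding has_weak_jacobian_def by auto
  have "AE x in lebesgue_on \<Omega>. G x $ i $ j - H x $ i $ j = 0" for i j
  proof (rule fundamental_lemma[OF \<Omega>])
    show "locally_integrable \<Omega> (\<lambda>x. G x $ i $ j - H x $ i $ j)"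
      using locally_integrable_nth2[OF li(1), of i j] locally_integrable_nth2[OF li(2), of i j]
      unfolding locally_integrable_def by auto
    fix \<psi> :: "real^2 \<Rightarrow> real" assume \<psi>: "\<psi> \<in> test_functions \<Omega>"
    then have c: "continuous_on UNIV \<psi>" unfolding test_functions_def by (auto dest: spec[of _ 0])
    obtain K where K: "compact K" "K \<subseteq> \<Omega>" "\<And>x. x \<notin> K \<Longrightarrow> \<psi> x = 0" using test_functionsE[OF \<psi>] by metis
    note I = integrable_mult_compact_support[OF \<Omega> locally_integrable_nth2[OF li(1)] c K]
      integrable_mult_compact_support[OF \<Omega> locally_integrable_nth2[OF li(2)] c K]
    have "integral\<^sup>L (lebesgue_on \<Omega>) (\<lambda>x. u x $ i * frechet_derivative \<psi> (at x) (axis j 1)) =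
        - integral\<^sup>L (lebesgue_on \<Omega>) (\<lambda>x. W x $ i $ j * \<psi> x)" if "has_weak_jacobian \<Omega> u W" for W
      using that \<psi> unfolding has_weak_jacobian_def by blast
    from this[OF G] this[OF H]
    have "integral\<^sup>L (lebesgue_on \<Omega>) (\<lambda>x. G x $ i $ j * \<psi> x) = integral\<^sup>L (lebesgue_on \<Omega>) (\<lambda>x. H x $ i $ j
        * \<psi> x)"
      by linarith
    then show "integral\<^sup>L (lebesgue_on \<Omega>) (\<lambda>x. (G x $ i $ j - H x $ i $ j) * \<psi> x) = 0"
      using I by (simp add: left_diff_distrib)
  qed
  then have "AE x in lebesgue_on \<Omega>. \<forall>i j. G x $ i $ j - H x $ i $ j = 0"
    by (simp add: AE_all_countable)
  then show ?thesis by eventually_elim (simp add: vec_eq_iff)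
qed

lemma pderiv_dir_support:
  fixes \<psi> :: "real^2 \<Rightarrow> real"
  assumes "\<psi> \<in> test_functions \<Omega>" "b \<in> Basis"
  obtains K where "compact K" "K \<subseteq> \<Omega>" "\<And>x. x \<notin> K \<Longrightarrow> \<psi> x = 0" "\<And>x. x \<notin> K \<Longrightarrow> pderiv_dir \<psi> b x = 0"
    "continuous_on UNIV \<psi>" "continuous_on UNIV (pderiv_dir \<psi> b)"
proof -
  obtain K where K: "compact K" "K \<subseteq> \<Omega>" "\<And>x. x \<notin> K \<Longrightarrow> \<psi> x = 0" using test_functionsE[OF assms(1)] by metis
  have C: "C_k (Suc 0) \<psi>" "C_k 0 \<psi>" using assms unfolding test_functions_def by blast+
  show ?thesis
    by (rule that[OF K]) (use C assms in \<open>auto simp: frechet_derivative_zero_outside[OF compact_imp_closed[OF K(1)] K(3)]\<close>)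
qed

lemma has_weak_jacobian_combination:
  assumes \<Omega>: "open \<Omega>" and G: "has_weak_jacobian \<Omega> u G" and H: "has_weak_jacobian \<Omega> v H"
  shows "has_weak_jacobian \<Omega> (\<lambda>x. s *\<^sub>R u x + t *\<^sub>R v x) (\<lambda>x. s *\<^sub>R G x + t *\<^sub>R H x)"
proof -
  have li: "locally_integrable \<Omega> G" "locally_integrable \<Omega> H" "locally_integrable \<Omega> u"
      "locally_integrable \<Omega> v"
    using G H unfolding has_weak_jacobian_def by auto
  have "integral\<^sup>L (lebesgue_on \<Omega>) (\<lambda>x. (s *\<^sub>R u x + t *\<^sub>R v x) $ i * frechet_derivative \<psi> (at x)
      (axis j 1)) =
        - integral\<^sup>L (lebesgue_on \<Omega>) (\<lambda>x. (s *\<^sub>R G x + t *\<^sub>R H x) $ i $ j * \<psi> x)"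
    if \<psi>: "\<psi> \<in> test_functions \<Omega>" for \<psi> :: "real^2 \<Rightarrow> real" and i j
  proof -
    obtain K where K: "compact K" "K \<subseteq> \<Omega>" "\<And>x. x \<notin> K \<Longrightarrow> \<psi> x = 0" "\<And>x. x \<notin> K \<Longrightarrow> pderiv_dir \<psi> (axis j 1) x = 0"
      "continuous_on UNIV \<psi>" "continuous_on UNIV (pderiv_dir \<psi> (axis j 1))"
      using pderiv_dir_support[OF \<psi>, of "axis j 1"] by (auto simp: axis_in_Basis_iff)
    note I = integrable_mult_compact_support[OF \<Omega> locally_integrable_nth2[OF li(1), of i j] K(5,1,2,3)]
      integrable_mult_compact_support[OF \<Omega> locally_integrable_nth2[OF li(2), of i j] K(5,1,2,3)]
      integrable_mult_compact_support[OF \<Omega> locally_integrable_nth[OF li(3), of i] K(6,1,2,4)]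
      integrable_mult_compact_support[OF \<Omega> locally_integrable_nth[OF li(4), of i] K(6,1,2,4)]
    have e: "(\<lambda>x. (s *\<^sub>R u x + t *\<^sub>R v x) $ i * frechet_derivative \<psi> (at x) (axis j 1)) =
       (\<lambda>x. s * (u x $ i * frechet_derivative \<psi> (at x) (axis j 1)) + t * (v x $ i * frechet_derivative \<psi>
           (at x) (axis j 1)))"
      "(\<lambda>x. (s *\<^sub>R G x + t *\<^sub>R H x) $ i $ j * \<psi> x) = (\<lambda>x. s * (G x $ i $ j * \<psi> x) + t * (H x $ i $ j
          * \<psi> x))"
      by (auto simp: algebra_simps)
    show ?thesis
      unfolding e using I \<psi> G H
      by (simp add: has_weak_jacobian_def)
  qed
  moreover have "locally_integrable \<Omega> (\<lambda>x. s *\<^sub>R u x + t *\<^sub>R v x)" "locally_integrable \<Omega> (\<lambda>x. s *\<^sub>R G x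
      + t *\<^sub>R H x)"
    using li unfolding locally_integrable_def by auto
  ultimately show ?thesis unfolding has_weak_jacobian_def by blast
qed

subsection \<open>Energies of test functions and of convex integrands\<close>

lemma continuous_on_test_function:
  "\<psi> \<in> test_functions \<Omega> \<Longrightarrow> continuous_on UNIV \<psi>"
  unfolding test_functions_def by (auto dest: spec[of _ 0])

lemma test_function_nth:
  assumes "\<phi> \<in> test_functions \<Omega>"
  shows "(\<lambda>x. (\<phi> x :: real^'m) $ i) \<in> test_functions \<Omega>"
proof -
  obtain K where "compact K" "K \<subseteq> \<Omega>" "\<And>x. x \<notin> K \<Longrightarrow> \<phi> x = 0" using test_functionsE[OF assms] by metis
  then show ?thesis
    using assms by (intro test_functionsI[of _ K] C_k_nth_comp) (auto simp: test_functions_def)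
qed

lemma test_function_C1_compact:
  assumes "\<psi> \<in> test_functions \<Omega>" shows "C1_compact \<psi>"
proof -
  obtain K where "compact K" "\<And>x. x \<notin> K \<Longrightarrow> \<psi> x = 0" using test_functionsE[OF assms] by metis
  moreover have "C_k 1 \<psi>" using assms unfolding test_functions_def by blast
  ultimately show ?thesis unfolding C1_compact_def by blast
qed

lemma test_function_has_derivative:
  assumes "\<phi> \<in> test_functions \<Omega>"
  shows "(\<phi> has_derivative frechet_derivative \<phi> (at x)) (at x)"
  using assms C_k_has_derivative unfolding test_functions_def by blast

section \<open>Classical Jacobians of test functions as weak Jacobians\<close>

lemma jacobian_nth:
  fixes \<phi> :: "real^2 \<Rightarrow> real^2"
  assumes "\<phi> \<in> test_functions \<Omega>"
  shows "jacobian \<phi> (at x) $ i $ j = pderiv_dir (\<lambda>x. \<phi> x $ i) (axis j 1) x"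
proof -
  have "((\<lambda>x. \<phi> x $ i) has_derivative (\<lambda>h. frechet_derivative \<phi> (at x) h $ i)) (at x)"
    by (rule bounded_linear.has_derivative[OF bounded_linear_vec_nth test_function_has_derivative[OF assms]])
  from frechet_derivative_at[OF this] show ?thesis
    by (metis (mono_tags, lifting) jacobian_def matrix_def vec_lambda_beta)
qed

lemma axis_1_Basis: "axis j (1::real) \<in> Basis"
  by (simp add: axis_in_Basis_iff)

lemma continuous_on_jacobian:
  fixes \<phi> :: "real^2 \<Rightarrow> real^2"
  assumes "\<phi> \<in> test_functions \<Omega>"
  shows "continuous_on UNIV (\<lambda>x. jacobian \<phi> (at x))"
proof -
  have "continuous_on UNIV (\<lambda>x. \<chi> i j. jacobian \<phi> (at x) $ i $ j)"
    unfolding jacobian_nth[OF assms]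
    by (intro continuous_on_vec_lambda
        C1_compactD(2)[OF test_function_C1_compact[OF test_function_nth[OF assms]] axis_1_Basis])
  then show ?thesis by simp
qed

lemma jacobian_support:
  fixes \<phi> :: "real^2 \<Rightarrow> real^2"
  assumes "\<phi> \<in> test_functions \<Omega>"
  obtains K where "compact K" "K \<subseteq> \<Omega>" "\<And>x. x \<notin> K \<Longrightarrow> \<phi> x = 0" "\<And>x. x \<notin> K \<Longrightarrow> jacobian \<phi> (at x) = 0"
proof -
  obtain K where K: "compact K" "K \<subseteq> \<Omega>" "\<And>x. x \<notin> K \<Longrightarrow> \<phi> x = 0" using test_functionsE[OF assms] by metis
  have "jacobian \<phi> (at x) = 0" if "x \<notin> K" for x
  proof -
    have "frechet_derivative \<phi> (at x) = (\<lambda>h. 0)"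
      by (rule frechet_derivative_zero_outside[OF compact_imp_closed[OF K(1)] K(3) that])
    then show ?thesis by (simp add: jacobian_def matrix_def vec_eq_iff)
  qed
  then show ?thesis using that[OF K] by simp
qed

text \<open>A bridge between two settings: translation arguments use \<open>lborel\<close> on the
  whole space, whereas energies use the completed measure on \<Omega>.\<close>

lemma lebesgue_on_lborel:
  fixes F :: "'a::euclidean_space \<Rightarrow> real"
  assumes "open \<Omega>" "F \<in> borel_measurable borel" "\<And>x. x \<notin> \<Omega> \<Longrightarrow> F x = 0"
  shows "integral\<^sup>L (lebesgue_on \<Omega>) F = integral\<^sup>L lborel F"
    "integrable (lebesgue_on \<Omega>) F \<longleftrightarrow> integrable lborel F"
proof -
  have e: "(\<lambda>x. indicator \<Omega> x * F x) = F" "(\<lambda>x. indicator \<Omega> x *\<^sub>R F x) = F"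
    using assms(3) by (intro ext; force simp: indicator_def)+
  show "integral\<^sup>L (lebesgue_on \<Omega>) F = integral\<^sup>L lborel F"
    unfolding integral_lebesgue_on_restrict[OF assms(1)] e
    by (rule integral_completion) (use assms in simp)
  have "integrable (lebesgue_on \<Omega>) F \<longleftrightarrow> integrable lebesgue F"
    using assms by (subst integrable_restrict_space) (auto simp: e)
  also have "\<dots> \<longleftrightarrow> integrable lborel F"
    by (rule integrable_completion) (use assms in simp)
  finally show "integrable (lebesgue_on \<Omega>) F \<longleftrightarrow> integrable lborel F" .
qed

lemma integrable_lebesgue_on:
  fixes F :: "'a::euclidean_space \<Rightarrow> 'b::euclidean_space"
  assumes "integrable lborel F" "S \<in> sets lebesgue"
  shows "integrable (lebesgue_on S) F"
proof -
  have "integrable lebesgue F" using assms(1) integrable_completion[of F lborel] by auto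
  then show ?thesis using assms(2)
    by (subst integrable_restrict_space) (auto intro!: integrable_mult_indicator)
qed

text \<open>The product of the two functions is C^1 with compact support, so its derivative
  integrates to zero; the product rule splits that integral.\<close>

lemma integration_by_parts:
  assumes \<Omega>: "open \<Omega>" and f: "f \<in> test_functions \<Omega>" "\<psi> \<in> test_functions \<Omega>" and b: "b \<in> Basis"
  shows "integral\<^sup>L (lebesgue_on \<Omega>) (\<lambda>x. f x * pderiv_dir \<psi> b x) =
    - integral\<^sup>L (lebesgue_on \<Omega>) (\<lambda>x. pderiv_dir f b x * \<psi> x)"
proof -
  obtain K where K: "compact K" "K \<subseteq> \<Omega>" "\<And>x. x \<notin> K \<Longrightarrow> f x = 0" "\<And>x. x \<notin> K \<Longrightarrow> pderiv_dir f b x = 0"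
    and c: "continuous_on UNIV f" "continuous_on UNIV (pderiv_dir f b)"
    using pderiv_dir_support[OF f(1) b] by metis
  note c = c C1_compactD(1,2)[OF test_function_C1_compact[OF f(2)] b]
  have p: "C1_compact (\<lambda>x. f x * \<psi> x)"
  proof -
    have "C_k 1 f" "C_k 1 \<psi>" using f unfolding test_functions_def by blast+
    then have "C_k 1 (\<lambda>x. f x * \<psi> x)" by (rule C_k_mult)
    then show ?thesis using K(1,3) unfolding C1_compact_def by (metis mult_zero_left)
  qed
  have "((\<lambda>x. f x * \<psi> x) has_derivative (\<lambda>h. f x * frechet_derivative \<psi> (at x) h + frechet_derivative f
      (at x) h * \<psi> x)) (at x)" for x
    by (rule has_derivative_mult[OF f[THEN test_function_has_derivative]])
  then have d: "pderiv_dir (\<lambda>x. f x * \<psi> x) b = (\<lambda>x. f x * pderiv_dir \<psi> b x + pderiv_dir f b x * \<psi> x)"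
    using frechet_derivative_at by (metis (no_types, lifting))
  have i: "integrable lborel (\<lambda>x. f x * pderiv_dir \<psi> b x)" "integrable lborel (\<lambda>x. pderiv_dir f b x * \<psi> x)"
    by (rule integrable_compact_support[OF _ K(1)], use K c in \<open>auto intro!: continuous_intros\<close>)+
  have "integral\<^sup>L lborel (\<lambda>x. f x * pderiv_dir \<psi> b x) + integral\<^sup>L lborel (\<lambda>x. pderiv_dir f b x * \<psi> x) = 0"
    using integral_pderiv_dir_zero[OF p b] i unfolding d by simp
  moreover have "integral\<^sup>L (lebesgue_on \<Omega>) (\<lambda>x. f x * pderiv_dir \<psi> b x) = integral\<^sup>L lborel (\<lambda>x. f x
      * pderiv_dir \<psi> b x)"
    "integral\<^sup>L (lebesgue_on \<Omega>) (\<lambda>x. pderiv_dir f b x * \<psi> x) = integral\<^sup>L lborel (\<lambda>x. pderiv_dir f b x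
        * \<psi> x)"
    by (rule lebesgue_on_lborel[OF \<Omega>], use K c in \<open>force intro!: borel_measurable_continuous_onI
        continuous_intros\<close>,
        use K in \<open>metis mult_zero_left subsetD\<close>)+
  ultimately show ?thesis by simp
qed

lemma has_weak_jacobian_test_function:
  fixes \<phi> :: "real^2 \<Rightarrow> real^2"
  assumes \<Omega>: "open \<Omega>" and \<phi>: "\<phi> \<in> test_functions \<Omega>"
  shows "has_weak_jacobian \<Omega> \<phi> (\<lambda>x. jacobian \<phi> (at x))"
proof -
  obtain K where K: "compact K" "K \<subseteq> \<Omega>" "\<And>x. x \<notin> K \<Longrightarrow> \<phi> x = 0" "\<And>x. x \<notin> K \<Longrightarrow> jacobian \<phi> (at x) = 0"
    using jacobian_support[OF \<phi>] by metis
  have "integrable lborel \<phi>" "integrable lborel (\<lambda>x. jacobian \<phi> (at x))"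
    using integrable_compact_support[OF _ K(1)] K continuous_on_test_function[OF \<phi>]
        continuous_on_jacobian[OF \<phi>]
    by blast+
  then have "locally_integrable \<Omega> \<phi>" "locally_integrable \<Omega> (\<lambda>x. jacobian \<phi> (at x))"
    unfolding locally_integrable_def by (auto intro!: integrable_lebesgue_on sets_completionI_sets intro: borel_compact)
  then show ?thesis
    unfolding has_weak_jacobian_def jacobian_nth[OF \<phi>]
    using integration_by_parts[OF \<Omega> test_function_nth[OF \<phi>] _ axis_1_Basis] by blast
qed

lemma borel_measurable_lebesgue_on_continuous:
  fixes f :: "'a::euclidean_space \<Rightarrow> 'b::topological_space"
  assumes "continuous_on UNIV f" shows "f \<in> borel_measurable (lebesgue_on S)"
  using borel_measurable_continuous_onI[OF assms]
  by (intro measurable_restrict_space1 measurable_completion) simp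

text \<open>Boundedness comes from compact support, and the constant sequence \<phi> witnesses
  membership in the closure.\<close>

lemma test_function_W0_1_inf:
  fixes \<phi> :: "real^2 \<Rightarrow> real^2"
  assumes \<Omega>: "open \<Omega>" and \<phi>: "\<phi> \<in> test_functions \<Omega>"
  shows "\<phi> \<in> W0_1_inf \<Omega>"
proof -
  obtain K where K: "compact K" "K \<subseteq> \<Omega>" "\<And>x. x \<notin> K \<Longrightarrow> \<phi> x = 0" "\<And>x. x \<notin> K \<Longrightarrow> jacobian \<phi> (at x) = 0"
    using jacobian_support[OF \<phi>] by metis
  note c = continuous_on_test_function[OF \<phi>] continuous_on_jacobian[OF \<phi>]
  note W = has_weak_jacobian_test_function[OF \<Omega> \<phi>]
  have "integrable (lebesgue_on \<Omega>) \<phi>" "integrable (lebesgue_on \<Omega>) (\<lambda>x. jacobian \<phi> (at x))"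
    using integrable_compact_support[OF _ K(1)] K c \<Omega> by (auto intro!: integrable_lebesgue_on)
  then have "\<phi> \<in> W0_1_1 \<Omega>"
    unfolding W0_1_1_def using W \<phi> 
    by (auto intro!: exI[of _ "\<lambda>x. jacobian \<phi> (at x)"] exI[of _ "\<lambda>_. \<phi>"])
  moreover have "f \<in> L_infinity \<Omega>"
    if f: "continuous_on UNIV f" "\<And>x. x \<notin> K \<Longrightarrow> f x = 0" for f :: "real^2 \<Rightarrow> 'c::euclidean_space"
  proof -
    obtain B where "\<And>x. norm (f x) \<le> B" using compact_support_bounded[OF f(1) K(1) f(2)] by metis
    then show ?thesis
      using borel_measurable_lebesgue_on_continuous[OF f(1)] unfolding L_infinity_def by auto
  qed
  then have "\<phi> \<in> L_infinity \<Omega>" "(\<lambda>x. jacobian \<phi> (at x)) \<in> L_infinity \<Omega>"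
    using c K by blast+
  ultimately show ?thesis unfolding W0_1_inf_def W_1_inf_def using W by auto
qed

text \<open>The restricted Lebesgue measure is complete, so a change on a null set preserves
  measurability. This is applied to \<open>weak_jacobian\<close>, which is determined only almost
  everywhere.\<close>

lemma borel_measurable_lebesgue_on_AE:
  assumes S: "S \<in> sets lebesgue" and h: "h \<in> borel_measurable (lebesgue_on S)"
    and ae: "AE x in lebesgue_on S. h x = f x"
  shows "f \<in> borel_measurable (lebesgue_on S)"
proof -
  interpret complete_measure "lebesgue_on S"
  proof
    fix A B :: "'a set" assume "B \<subseteq> A" "A \<in> null_sets (lebesgue_on S)"
    then show "B \<in> sets (lebesgue_on S)"
      using completion.complete2[of B A lborel] S
      by (auto simp: null_sets_restrict_space sets_restrict_space_iff)
  qed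
  show ?thesis
  proof (rule measurableI)
    fix B :: "'b set" assume B: "B \<in> sets borel"
    show "f -` B \<inter> space (lebesgue_on S) \<in> sets (lebesgue_on S)"
    proof (rule in_sets_AE[OF _ measurable_sets[OF h B]])
      show "AE x in lebesgue_on S. (x \<in> h -` B \<inter> space (lebesgue_on S)) = (x \<in> f -` B \<inter> space
          (lebesgue_on S))"
        using ae by eventually_elim auto
    qed auto
  qed simp
qed

lemma weak_jacobian_AE:
  assumes \<Omega>: "open \<Omega>" and G: "has_weak_jacobian \<Omega> u G"
  shows "AE x in lebesgue_on \<Omega>. G x = weak_jacobian \<Omega> u x"
proof -
  have "has_weak_jacobian \<Omega> u (weak_jacobian \<Omega> u)"
    unfolding weak_jacobian_def by (rule someI[where P="has_weak_jacobian \<Omega> u", OF G])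
  from weak_jacobian_unique[OF \<Omega> G this] show ?thesis .
qed

lemma energy_eq:
  assumes \<Omega>: "open \<Omega>" and G: "has_weak_jacobian \<Omega> u G" "G \<in> borel_measurable (lebesgue_on \<Omega>)"
    and f: "continuous_on UNIV f"
  shows "energy \<Omega> f u = integral\<^sup>L (lebesgue_on \<Omega>) (\<lambda>x. f (G x))"
proof -
  note ae = weak_jacobian_AE[OF \<Omega> G(1)]
  have fm: "f \<in> borel_measurable borel" using f by (rule borel_measurable_continuous_onI)
  have W: "weak_jacobian \<Omega> u \<in> borel_measurable (lebesgue_on \<Omega>)"
    by (rule borel_measurable_lebesgue_on_AE[OF _ G(2) ae]) (use \<Omega> in simp)
  show ?thesis
    unfolding energy_def
  proof (rule integral_cong_AE)
    show "(\<lambda>x. f (weak_jacobian \<Omega> u x)) \<in> borel_measurable (lebesgue_on \<Omega>)"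
      "(\<lambda>x. f (G x)) \<in> borel_measurable (lebesgue_on \<Omega>)"
      using measurable_compose[OF W fm] measurable_compose[OF G(2) fm] .
    show "AE x in lebesgue_on \<Omega>. f (weak_jacobian \<Omega> u x) = f (G x)"
      using ae by eventually_elim simp
  qed
qed

lemma energy_test_function:
  assumes \<Omega>: "open \<Omega>" and "\<phi> \<in> test_functions \<Omega>" "continuous_on UNIV f"
  shows "energy \<Omega> f \<phi> = integral\<^sup>L (lebesgue_on \<Omega>) (\<lambda>x. f (jacobian \<phi> (at x)))"
  using assms by (intro energy_eq has_weak_jacobian_test_function
      borel_measurable_lebesgue_on_continuous continuous_on_jacobian)

text \<open>Pointwise convexity is integrated. Bounded Jacobians on a set of finite measure make all
  compositions integrable, which matters because a non-integrable function has integral 0 by default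
  and monotonicity would break down.\<close>

lemma integral_convex_if_convex:
  assumes \<Omega>: "open \<Omega>" "bounded \<Omega>" and f: "continuous_on UNIV f" "convex_on UNIV f"
  shows "integral_convex \<Omega> f"
  unfolding integral_convex_def
proof (intro ballI)
  fix u v and t :: real
  assume "u \<in> W0_1_inf \<Omega>" "v \<in> W0_1_inf \<Omega>" and t: "t \<in> {0..1}"
  then obtain G H where G: "has_weak_jacobian \<Omega> u G" "G \<in> L_infinity \<Omega>"
    and H: "has_weak_jacobian \<Omega> v H" "H \<in> L_infinity \<Omega>"
    unfolding W0_1_inf_def W_1_inf_def by auto
  have fm: "f \<in> borel_measurable borel" using f(1) by (rule borel_measurable_continuous_onI)
  have int: "integrable (lebesgue_on \<Omega>) (\<lambda>x. f (G x))" if L: "G \<in> L_infinity \<Omega>" for G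
  proof -
    obtain C where m: "G \<in> borel_measurable (lebesgue_on \<Omega>)" and C: "AE x in lebesgue_on \<Omega>. norm (G x) \<le> C"
      using L unfolding L_infinity_def by blast
    have "bounded (f ` cball 0 C)"
      using f(1) by (intro compact_imp_bounded compact_continuous_image) (auto intro: continuous_on_subset)
    then obtain B where B: "\<And>M. norm M \<le> C \<Longrightarrow> norm (f M) \<le> B"
      unfolding bounded_iff by (metis image_eqI mem_cball_0)
    interpret finite_measure "lebesgue_on \<Omega>"
      using \<Omega> emeasure_bounded_finite[OF \<Omega>(2)]
      by (intro finite_measureI) (simp add: emeasure_restrict_space less_top)
    show ?thesis
    proof (rule integrable_const_bound)
      show "AE x in lebesgue_on \<Omega>. norm (f (G x)) \<le> B" using C by eventually_elim (rule B)
      show "(\<lambda>x. f (G x)) \<in> borel_measurable (lebesgue_on \<Omega>)" using measurable_compose[OF m fm] .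
    qed
  qed
  have m: "G \<in> borel_measurable (lebesgue_on \<Omega>)" "H \<in> borel_measurable (lebesgue_on \<Omega>)"
    using G H unfolding L_infinity_def by auto
  define J where "J = (\<lambda>x. (1 - t) *\<^sub>R G x + t *\<^sub>R H x)"
  have J: "has_weak_jacobian \<Omega> (\<lambda>x. (1 - t) *\<^sub>R u x + t *\<^sub>R v x) J"
    unfolding J_def by (rule has_weak_jacobian_combination[OF \<Omega>(1) G(1) H(1)])
  have mJ: "J \<in> borel_measurable (lebesgue_on \<Omega>)" unfolding J_def using m by measurable
  have JL: "J \<in> L_infinity \<Omega>"
  proof -
    obtain C D where C: "AE x in lebesgue_on \<Omega>. norm (G x) \<le> C" and D: "AE x in lebesgue_on \<Omega>. norm (H x)
        \<le> D"
      using G H unfolding L_infinity_def by auto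
    have "AE x in lebesgue_on \<Omega>. norm (J x) \<le> (1 - t) * C + t * D"
      using C D
    proof eventually_elim
      case (elim x)
      have "norm (J x) \<le> (1 - t) * norm (G x) + t * norm (H x)"
        unfolding J_def using t by (intro norm_triangle_le) auto
      also have "\<dots> \<le> (1 - t) * C + t * D" using elim t by (intro add_mono mult_left_mono) auto
      finally show ?case .
    qed
    then show ?thesis using mJ unfolding L_infinity_def by auto
  qed
  have "energy \<Omega> f (\<lambda>x. (1 - t) *\<^sub>R u x + t *\<^sub>R v x) = integral\<^sup>L (lebesgue_on \<Omega>) (\<lambda>x. f (J x))"
    by (rule energy_eq[OF \<Omega>(1) J mJ f(1)])
  also have "\<dots> \<le> integral\<^sup>L (lebesgue_on \<Omega>) (\<lambda>x. (1 - t) * f (G x) + t * f (H x))"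
  proof (rule integral_mono)
    show "integrable (lebesgue_on \<Omega>) (\<lambda>x. f (J x))" using int[OF JL] .
    show "integrable (lebesgue_on \<Omega>) (\<lambda>x. (1 - t) * f (G x) + t * f (H x))"
      using int[OF G(2)] int[OF H(2)] by auto
    show "f (J x) \<le> (1 - t) * f (G x) + t * f (H x)" for x
      unfolding J_def using convex_onD[OF f(2), of t "G x" "H x"] t by auto
  qed
  also have "\<dots> = (1 - t) * energy \<Omega> f u + t * energy \<Omega> f v"
    using int[OF G(2)] int[OF H(2)] energy_eq[OF \<Omega>(1) G(1) m(1) f(1)] energy_eq[OF \<Omega>(1) H(1) m(2) f(1)]
        by simp
  finally show "energy \<Omega> f (\<lambda>x. (1 - t) *\<^sub>R u x + t *\<^sub>R v x) \<le> (1 - t) * energy \<Omega> f u + t * energy \<Omega> f v" .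
qed

subsection \<open>Oscillating test maps\<close>

lemma g_entries:
  "g k M = ((M$1$1)\<^sup>2 + (M$1$2)\<^sup>2 + (M$2$1)\<^sup>2 + (M$2$2)\<^sup>2)\<^sup>2 + k * (M$1$1 * M$2$2 - M$1$2 * M$2$1)\<^sup>2"
proof -
  have "norm M ^ 4 = ((norm M)\<^sup>2)\<^sup>2" by simp
  also have "(norm M)\<^sup>2 = M \<bullet> M" by (simp add: power2_norm_eq_inner)
  also have "M \<bullet> M = (M$1$1)\<^sup>2 + (M$1$2)\<^sup>2 + (M$2$1)\<^sup>2 + (M$2$2)\<^sup>2"
    by (simp add: inner_vec_def sum_2 power2_eq_square)
  finally show ?thesis by (simp add: g_def det_2)
qed

lemma continuous_on_g: "continuous_on S (g k)"
  unfolding g_entries by (intro continuous_intros)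

lemma C_k_vec:
  fixes f :: "'a::euclidean_space \<Rightarrow> real^'m"
  assumes "\<And>i. C_k n (\<lambda>x. f x $ i)" shows "C_k n f"
proof -
  have "C_k n (\<lambda>x. \<Sum>i\<in>A. f x $ i *\<^sub>R axis i 1)" if "finite A" for A :: "'m set"
    using that by induction (auto intro!: C_k_const C_k_add C_k_scaleR assms)
  moreover have "(\<Sum>i\<in>UNIV. f x $ i *\<^sub>R axis i 1) = f x" for x
    using basis_expansion[of "f x"] by (simp add: scalar_mult_eq_scaleR)
  ultimately show ?thesis by (metis (no_types, lifting) ext finite)
qed

text \<open>Left multiplication by the diagonal matrix with entries \<open>c\<close>; applied to
  \<open>mat 1\<close> it returns that diagonal matrix.\<close>

definition row_scale :: "real^2 \<Rightarrow> real^2^2 \<Rightarrow> real^2^2" where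
  "row_scale c T = (\<chi> i j. c $ i * T $ i $ j)"

text \<open>The Jacobian of \<open>laminate\<close> with unit amplitudes, \<open>s\<close> playing
  the role of the slope of \<open>w\<close>. Passing \<open>s\<close> separately admits the sharp
  zigzag, which is not differentiable at its corners. \<open>Suc N\<close> keeps the frequency
  nonzero.\<close>

definition oscillation ::
    "(real^2 \<Rightarrow> real) \<Rightarrow> (real \<Rightarrow> real) \<Rightarrow> (real \<Rightarrow> real) \<Rightarrow> nat \<Rightarrow> real^2 \<Rightarrow> real^2^2" where
  "oscillation \<zeta> s w N x = (\<chi> i j. \<zeta> x * (if i = j then s (real (Suc N) * x $ i) else 0) +
      pderiv_dir \<zeta> (axis j 1) x * (w (real (Suc N) * x $ i) / real (Suc N)))"

text \<open>Linear in the amplitude \<open>c\<close> while the oscillation stays fixed, so convex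
  combinations of two such maps remain in the family.\<close>

definition laminate :: "(real^2 \<Rightarrow> real) \<Rightarrow> (real \<Rightarrow> real) \<Rightarrow> nat \<Rightarrow> real^2 \<Rightarrow> real^2 \<Rightarrow> real^2" where
  "laminate \<zeta> w N c x = (\<chi> i. c $ i * (\<zeta> x * (w (real (Suc N) * x $ i) / real (Suc N))))"

lemma laminate_test_function:
  assumes \<zeta>: "\<zeta> \<in> test_functions \<Omega>" and w: "\<And>n. C_k n w"
  shows "laminate \<zeta> w N c \<in> test_functions \<Omega>"
proof -
  obtain K where K: "compact K" "K \<subseteq> \<Omega>" "\<And>x. x \<notin> K \<Longrightarrow> \<zeta> x = 0" using test_functionsE[OF \<zeta>] by metis
  show ?thesis
  proof (rule test_functionsI[OF _ K(1,2)])
    have "C_k n \<zeta>" for n using \<zeta> unfolding test_functions_def by blast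
    then show "C_k n (laminate \<zeta> w N c)" for n
      unfolding divide_inverse laminate_def
      by (intro C_k_vec) (simp only: vec_lambda_beta, intro C_k_mult C_k_const C_k_compose[OF w] C_k_nth)
  qed (simp add: laminate_def K vec_eq_iff)
qed

lemma jacobian_laminate:
  assumes \<zeta>: "\<zeta> \<in> test_functions \<Omega>" and w: "\<And>n. C_k n w"
    and s: "\<And>t. (w has_real_derivative s t) (at t)"
  shows "jacobian (laminate \<zeta> w N c) (at x) = row_scale c (oscillation \<zeta> s w N x)"
proof -
  have "jacobian (laminate \<zeta> w N c) (at x) $ i $ j = row_scale c (oscillation \<zeta> s w N x) $ i $ j" for i j
  proof -
    have 1: "((\<lambda>x::real^2. real (Suc N) * x $ i) has_derivative (\<lambda>h. real (Suc N) * h $ i)) (at x)"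
      by (intro derivative_intros bounded_linear.has_derivative[OF bounded_linear_vec_nth])
    have 2: "((\<lambda>x. w (real (Suc N) * x $ i)) has_derivative (\<lambda>h. s (real (Suc N) * x $ i) * (real (Suc N)
        * h $ i))) (at x)"
      using has_derivative_compose[OF 1 s[unfolded has_field_derivative_def]] .
    have 3: "((\<lambda>x. c $ i * (\<zeta> x * (inverse (real (Suc N)) * w (real (Suc N) * x $ i)))) has_derivative
        (\<lambda>h. c $ i * (\<zeta> x * (inverse (real (Suc N)) * (s (real (Suc N) * x $ i) * (real (Suc N) * h $ i))) +
         frechet_derivative \<zeta> (at x) h * (inverse (real (Suc N)) * w (real (Suc N) * x $ i))))) (at x)"
      by (intro has_derivative_mult_right has_derivative_mult test_function_has_derivative[OF \<zeta>] 2)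
    have 4: "(\<lambda>x. laminate \<zeta> w N c x $ i) = (\<lambda>x. c $ i * (\<zeta> x * (inverse (real (Suc N)) * w (real (Suc N)
        * x $ i))))"
      unfolding laminate_def by (simp add: divide_inverse mult.commute)
    have "pderiv_dir (\<lambda>x. laminate \<zeta> w N c x $ i) (axis j 1) x =
        c $ i * (\<zeta> x * (inverse (real (Suc N)) * (s (real (Suc N) * x $ i) * (real (Suc N)
            * axis j 1 $ i))) +
         pderiv_dir \<zeta> (axis j 1) x * (inverse (real (Suc N)) * w (real (Suc N) * x $ i)))"
      unfolding 4 frechet_derivative_at[OF 3, symmetric] ..
    also have "\<dots> = row_scale c (oscillation \<zeta> s w N x) $ i $ j"
      by (simp add: row_scale_def oscillation_def axis_def divide_inverse mult.commute del: of_nat_Suc)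
    finally show ?thesis unfolding jacobian_nth[OF laminate_test_function[OF \<zeta> w]] .
  qed
  then show ?thesis by (simp add: vec_eq_iff)
qed

text \<open>Each of the four entries is at most 1 from the slope term plus 2 B from the term with
  the gradient of \<zeta>. Nothing depends on the frequency or the smoothing, so the bound serves
  for domination in both limits.\<close>

lemma oscillation_bound:
  assumes \<zeta>: "\<And>x. \<bar>\<zeta> x\<bar> \<le> 1" "\<And>x j. \<bar>pderiv_dir \<zeta> (axis j 1) x\<bar> \<le> B"
    and s: "\<And>t. \<bar>s t\<bar> \<le> 1" and w: "\<And>t. \<bar>w t\<bar> \<le> 2"
  shows "norm (oscillation \<zeta> s w N x) \<le> 4 * (1 + B * 2)"
proof -
  have B: "0 \<le> B" using \<zeta>(2)[of 1 0] by linarith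
  have "\<bar>oscillation \<zeta> s w N x $ i $ j\<bar> \<le> 1 + B * 2" for i j
  proof -
    have "\<bar>\<zeta> x * (if i = j then s (real (Suc N) * x $ i) else 0)\<bar> \<le> 1 * 1"
      unfolding abs_mult using s by (intro mult_mono \<zeta>) auto
    moreover have "\<bar>w (real (Suc N) * x $ i) / real (Suc N)\<bar> \<le> 2 / 1"
      unfolding abs_divide by (intro frac_le w) auto
    then have "\<bar>pderiv_dir \<zeta> (axis j 1) x * (w (real (Suc N) * x $ i) / real (Suc N))\<bar> \<le> B * 2"
      unfolding abs_mult using B by (intro mult_mono \<zeta>) (auto simp del: of_nat_Suc)
    ultimately show ?thesis unfolding oscillation_def vec_lambda_beta by linarith
  qed note e = this
  have "norm (oscillation \<zeta> s w N x) \<le> (\<Sum>i\<in>UNIV. norm (oscillation \<zeta> s w N x $ i))"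
    unfolding norm_vec_def by (rule L2_set_le_sum) simp
  also have "\<dots> \<le> (\<Sum>i\<in>UNIV. \<Sum>j\<in>UNIV. \<bar>oscillation \<zeta> s w N x $ i $ j\<bar>)"
    by (intro sum_mono norm_le_l1_cart)
  also have "\<dots> \<le> (\<Sum>i\<in>(UNIV::2 set). \<Sum>j\<in>(UNIV::2 set). 1 + B * 2)"
    by (intro sum_mono e)
  also have "\<dots> = 4 * (1 + B * 2)" by simp
  finally show ?thesis .
qed

text \<open>Because \<open>f 0 = 0\<close>, all integrands live on \<open>K\<close> and share a
  constant bound. Convergence is asked of \<open>f (T m x)\<close> only, since in the high-frequency
  limit the matrices themselves keep oscillating.\<close>

lemma integral_convergence_bounded_support:
  fixes T :: "nat \<Rightarrow> 'a::euclidean_space \<Rightarrow> 'b::euclidean_space" and f :: "'b \<Rightarrow> real"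
  assumes f: "continuous_on UNIV f" "f 0 = 0"
    and T: "\<And>m. T m \<in> borel_measurable borel" "\<And>m x. norm (T m x) \<le> C" "compact K" "\<And>m x. x \<notin> K \<Longrightarrow> T m x = 0"
    and lim: "AE x in lborel. (\<lambda>m. f (T m x)) \<longlonglongrightarrow> L x" and [measurable]: "L \<in> borel_measurable borel"
  shows "(\<lambda>m. integral\<^sup>L lborel (\<lambda>x. f (T m x))) \<longlonglongrightarrow> integral\<^sup>L lborel L"
proof -
  have "bounded (f ` cball 0 C)"
    using f(1) by (intro compact_imp_bounded compact_continuous_image) (auto intro: continuous_on_subset)
  then obtain B where B: "\<And>M. norm M \<le> C \<Longrightarrow> norm (f M) \<le> B"
    unfolding bounded_iff by (metis image_eqI mem_cball_0)
  note [measurable] = borel_measurable_continuous_onI[OF f(1)] T(1)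
  show ?thesis
  proof (rule integral_dominated_convergence)
    show "integrable lborel (\<lambda>x. B * indicator K x)"
      using T(3) emeasure_compact_finite[OF T(3)]
      by (intro integrable_mult_right integrable_real_indicator) (auto simp: compact_imp_closed)
    show "AE x in lborel. norm (f (T m x)) \<le> B * indicator K x" for m
      using B[OF T(2)] T(4) f(2) by (auto simp: indicator_def)
  qed (use lim in measurable)
qed

text \<open>Zeros of the cosine confine \<open>x\<close> to countably many hyperplanes. Off them no
  zigzag is at a corner, and every slope is 1 or -1.\<close>

lemma AE_cos_neq_0:
  "AE x in lborel. \<forall>N i. cos (real (Suc N) * (x::real^2) $ i) \<noteq> 0"
proof -
  have "AE x in lborel. \<forall>n::int. (x::real^2) \<bullet> axis i 1 \<noteq> of_int n * (pi / 2) / real (Suc N)" for N i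
    unfolding AE_all_countable by (intro allI AE_lborel_inner_neq axis_1_Basis)
  then have "AE x in lborel. \<forall>N i. \<forall>n::int. (x::real^2) $ i \<noteq> of_int n * (pi / 2) / real (Suc N)"
    unfolding AE_all_countable[where 'i=nat] AE_all_countable[where 'i=2] by (simp add: inner_axis)
  then show ?thesis
  proof eventually_elim
    case (elim x)
    show ?case
    proof (intro allI notI)
      fix N i assume "cos (real (Suc N) * x $ i) = 0"
      then obtain n :: int where "real (Suc N) * x $ i = of_int n * (pi / 2)"
        unfolding cos_zero_iff_int by auto
      then have "x $ i = of_int n * (pi / 2) / real (Suc N)" by (simp add: field_simps del: of_nat_Suc)
      then show False using elim by blast
    qed
  qed
qed

text \<open>The defect of midpoint convexity between diagonal left factors, with \<open>T\<close>
  fixed. A negative value at \<open>mat 1\<close> says that \<open>g k\<close> is not convex on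
  diagonal matrices.\<close>

definition convexity_gap :: "real \<Rightarrow> real^2 \<Rightarrow> real^2 \<Rightarrow> real^2^2 \<Rightarrow> real" where
  "convexity_gap k c d T =
     (g k (row_scale c T) + g k (row_scale d T)) / 2 - g k (row_scale ((1/2) *\<^sub>R c + (1/2) *\<^sub>R d) T)"

lemma continuous_on_row_scale: "continuous_on S (row_scale c)"
  unfolding row_scale_def by (intro continuous_on_vec_lambda continuous_intros)

lemma continuous_on_convexity_gap: "continuous_on S (convexity_gap k c d)"
  unfolding convexity_gap_def
  by (intro continuous_intros continuous_on_compose2[OF continuous_on_g continuous_on_row_scale]) auto

lemma convexity_gap_scaleR: "convexity_gap k c d (t *\<^sub>R T) = t ^ 4 * convexity_gap k c d T"
proof -
  have "g k (row_scale c (t *\<^sub>R T)) = t ^ 4 * g k (row_scale c T)" for c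
    unfolding g_entries row_scale_def by (simp add: power2_eq_square power4_eq_xxxx algebra_simps)
  then show ?thesis by (simp add: convexity_gap_def algebra_simps)
qed

text \<open>Column signs commute with row scaling, preserve the norm and change the determinant at
  most in sign, where only its square enters.\<close>

lemma convexity_gap_column_signs:
  assumes "\<And>j. (s j)\<^sup>2 = 1"
  shows "convexity_gap k c d (\<chi> i j. T $ i $ j * s j) = convexity_gap k c d T"
proof -
  have "g k (row_scale c (\<chi> i j. T $ i $ j * s j)) = g k (row_scale c T)" for c
  proof -
    have "g k (row_scale c (\<chi> i j. T $ i $ j * s j)) =
      (c$1^2 * T$1$1^2 * (s 1)\<^sup>2 + c$1^2 * T$1$2^2 * (s 2)\<^sup>2 + c$2^2 * T$2$1^2 * (s 1)\<^sup>2 + c$2^2 * T$2$2^2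
          * (s 2)\<^sup>2)\<^sup>2
       + k * ((c$1 * c$2 * (T$1$1 * T$2$2 - T$1$2 * T$2$1))\<^sup>2 * ((s 1)\<^sup>2 * (s 2)\<^sup>2))"
      unfolding g_entries row_scale_def by (simp add: power_mult_distrib)
          (simp add: power2_eq_square algebra_simps)
    also have "\<dots> = g k (row_scale c T)"
      unfolding assms g_entries row_scale_def by (simp add: power_mult_distrib)
          (simp add: power2_eq_square algebra_simps)
    finally show ?thesis .
  qed
  then show ?thesis by (simp add: convexity_gap_def)
qed

lemma borel_measurable_matrix:
  fixes T :: "'a \<Rightarrow> real^'n^'m"
  assumes "\<And>i j. (\<lambda>x. T x $ i $ j) \<in> borel_measurable M"
  shows "T \<in> borel_measurable M"
  unfolding borel_measurable_euclidean_space[of T]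
  by (auto simp: Basis_vec_def inner_axis assms)

lemma oscillation_measurable:
  assumes \<zeta>: "\<zeta> \<in> test_functions \<Omega>" and [measurable]: "s \<in> borel_measurable borel"
      "w \<in> borel_measurable borel"
  shows "oscillation \<zeta> s w N \<in> borel_measurable borel"
proof (rule borel_measurable_matrix)
  fix i j
  note c = C1_compactD(1,2)[OF test_function_C1_compact[OF \<zeta>] axis_1_Basis]
  note [measurable] = c[THEN borel_measurable_continuous_onI]
  have [measurable]: "(\<lambda>x::real^2. x $ i) \<in> borel_measurable borel"
    by (intro borel_measurable_continuous_onI continuous_intros)
  show "(\<lambda>x. oscillation \<zeta> s w N x $ i $ j) \<in> borel_measurable borel"
    unfolding oscillation_def vec_lambda_beta by measurable
qed

lemma row_scale_0: "row_scale c 0 = 0"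
  by (simp add: row_scale_def vec_eq_iff)

lemma g_0: "g k 0 = 0"
  by (simp add: g_entries)

lemma convexity_gap_0: "convexity_gap k c d 0 = 0"
  by (simp add: convexity_gap_def row_scale_0 g_0)

text \<open>This is convexity of the energy at t = 1/2, tested on two laminates that share \<zeta>,
  \<open>w\<close> and \<open>N\<close> and differ only in amplitude.\<close>

lemma integral_convexity_gap_nonneg:
  assumes \<Omega>: "open \<Omega>" and conv: "integral_convex \<Omega> (g k)" and \<zeta>: "\<zeta> \<in> test_functions \<Omega>"
    and w: "\<And>n. C_k n w" "\<And>t. (w has_real_derivative s t) (at t)"
  shows "0 \<le> integral\<^sup>L lborel (\<lambda>x. convexity_gap k c d (oscillation \<zeta> s w N x))"
proof -
  define T where "T = oscillation \<zeta> s w N"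
  note test = laminate_test_function[OF \<zeta> w(1)]
  have E: "energy \<Omega> (g k) (laminate \<zeta> w N c) = integral\<^sup>L (lebesgue_on \<Omega>) (\<lambda>x. g k (row_scale c (T x)))"
      for c
    unfolding energy_test_function[OF \<Omega> test continuous_on_g] jacobian_laminate[OF \<zeta> w] T_def ..
  have I: "integrable (lebesgue_on \<Omega>) (\<lambda>x. g k (row_scale c (T x)))" for c
  proof -
    obtain K where K: "compact K" "\<And>x. x \<notin> K \<Longrightarrow> jacobian (laminate \<zeta> w N c) (at x) = 0"
      using jacobian_support[OF test] by metis
    have "integrable lborel (\<lambda>x. g k (jacobian (laminate \<zeta> w N c) (at x)))"
      by (rule integrable_compact_support[OF _ K(1)])
        (auto simp: K g_0 intro!: continuous_on_compose2[OF continuous_on_g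
            continuous_on_jacobian[OF test]])
    then show ?thesis
      unfolding jacobian_laminate[OF \<zeta> w] T_def using \<Omega> by (intro integrable_lebesgue_on) auto
  qed
  have comb: "(\<lambda>x. (1 - 1/2) *\<^sub>R laminate \<zeta> w N c x + (1/2) *\<^sub>R laminate \<zeta> w N d x) =
      laminate \<zeta> w N ((1/2) *\<^sub>R c + (1/2) *\<^sub>R d)"
  proof -
    have "(1 - 1/2) * (p * X) + (1/2) * (q * X) = ((1/2) * p + (1/2) * q) * X" for p q X :: real
      by (simp add: algebra_simps)
    then show ?thesis
      by (simp only: laminate_def fun_eq_iff vec_eq_iff vector_add_component vector_scaleR_component vec_lambda_beta
          real_scaleR_def) simp
  qed
  have "energy \<Omega> (g k) (\<lambda>x. (1 - 1/2) *\<^sub>R laminate \<zeta> w N c x + (1/2) *\<^sub>R laminate \<zeta> w N d x)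
      \<le> (1 - 1/2) * energy \<Omega> (g k) (laminate \<zeta> w N c) + (1/2) * energy \<Omega> (g k) (laminate \<zeta> w N d)"
    by (rule conv[unfolded integral_convex_def, rule_format,
          OF test_function_W0_1_inf[OF \<Omega> test] test_function_W0_1_inf[OF \<Omega> test]]) simp
  then have "0 \<le> integral\<^sup>L (lebesgue_on \<Omega>) (\<lambda>x. convexity_gap k c d (T x))"
    unfolding comb E convexity_gap_def using I by simp
  also have "\<dots> = integral\<^sup>L lborel (\<lambda>x. convexity_gap k c d (T x))"
  proof (rule lebesgue_on_lborel(1)[OF \<Omega>])
    have "continuous_on UNIV w" using w(1)[of 0] by simp
    have "continuous_on UNIV (\<lambda>x. g k (jacobian (laminate \<zeta> w N c) (at x)))" for c
      by (rule continuous_on_compose2[OF continuous_on_g[of UNIV] continuous_on_jacobian[OF test]]) simp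
    then show "(\<lambda>x. convexity_gap k c d (T x)) \<in> borel_measurable borel"
      unfolding jacobian_laminate[OF \<zeta> w] T_def[symmetric] convexity_gap_def
      by (intro borel_measurable_continuous_onI continuous_intros) auto
    obtain K where K: "compact K" "K \<subseteq> \<Omega>" "\<And>x. x \<notin> K \<Longrightarrow> \<zeta> x = 0"
      using test_functionsE[OF \<zeta>] by metis
    fix x assume "x \<notin> \<Omega>"
    then have "x \<notin> K" using K by auto
    then have "T x = 0"
      using frechet_derivative_zero_outside[OF compact_imp_closed[OF K(1)] K(3)] K(3)
      by (simp add: T_def oscillation_def vec_eq_iff)
    then show "convexity_gap k c d (T x) = 0" by (simp add: convexity_gap_0)
  qed
  finally show ?thesis unfolding T_def .
qed

lemma not_integral_convexI:
  assumes \<Omega>: "open \<Omega>" "\<Omega> \<noteq> {}" and gap: "convexity_gap k c d (mat 1) < 0"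
  shows "\<not> integral_convex \<Omega> (g k)"
proof
  assume conv: "integral_convex \<Omega> (g k)"
  obtain p where "p \<in> \<Omega>" using \<Omega>(2) by auto
  then obtain a b where ab: "cbox a b \<subseteq> \<Omega>" "p \<in> box a b"
    by (rule open_contains_cbox[OF \<Omega>(1)])
  \<comment> \<open>The index 0 is arbitrary; what counts is smoothness, values in [0, 1], support
    in \<Omega> and positivity on the open box.\<close>
  define \<zeta> where "\<zeta> = box_bump a b 0"
  have \<zeta>: "\<zeta> \<in> test_functions \<Omega>" unfolding \<zeta>_def by (rule box_bump_test_function[OF ab(1)])
  have \<zeta>1: "\<bar>\<zeta> x\<bar> \<le> 1" for x using box_bump_bounds[of a b 0 x] by (simp add: \<zeta>_def)
  obtain K where K: "compact K" "K \<subseteq> \<Omega>" "\<And>x. x \<notin> K \<Longrightarrow> \<zeta> x = 0"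
    using test_functionsE[OF \<zeta>] by metis
  have K': "pderiv_dir \<zeta> h x = 0" if "x \<notin> K" for x h
    using frechet_derivative_zero_outside[OF compact_imp_closed[OF K(1)] K(3) that] by simp
  note cont = C1_compactD(1,2)[OF test_function_C1_compact[OF \<zeta>] axis_1_Basis]
  obtain B1 where B1: "\<And>x. \<bar>pderiv_dir \<zeta> (axis 1 1) x\<bar> \<le> B1"
    using compact_support_bounded[OF cont(2) K(1) K'] by (metis real_norm_def)
  obtain B2 where B2: "\<And>x. \<bar>pderiv_dir \<zeta> (axis 2 1) x\<bar> \<le> B2"
    using compact_support_bounded[OF cont(2) K(1) K'] by (metis real_norm_def)
  define B where "B = max B1 B2"
  have B: "\<bar>pderiv_dir \<zeta> (axis j 1) x\<bar> \<le> B" for x j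
    using B1[of x] B2[of x] exhaust_2[of j] by (auto simp: B_def)
  have supp: "oscillation \<zeta> s w N x = 0" if "x \<notin> K" for s w N x
    using K(3)[OF that] K'[OF that] by (simp add: oscillation_def vec_eq_iff)
  let ?gap = "convexity_gap k c d"
  note gapc = continuous_on_convexity_gap[of UNIV k c d]
  have gapm[measurable]: "?gap \<in> borel_measurable borel" using gapc by
      (rule borel_measurable_continuous_onI)
  define s where "s = (\<lambda>t::real. sgn (cos t))"
  define w where "w = (\<lambda>t::real. arcsin (sin t))"
  have sm: "s \<in> borel_measurable borel" unfolding s_def by measurable
  have wm: "w \<in> borel_measurable borel"
    unfolding w_def by (intro borel_measurable_continuous_onI continuous_intros) auto
  have s1: "\<bar>s t\<bar> \<le> 1" for t by (simp add: s_def sgn_if)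
  have w2: "\<bar>w t\<bar> \<le> 2" for t using zigzag_bound[of 1 t] by (simp add: w_def zigzag_def)
  \<comment> \<open>The sharp profile gives no test function, so the inequality is carried over from
    smooth profiles by letting \<open>r\<close> tend to 1 at fixed \<open>N\<close>.\<close>
  have nonneg: "0 \<le> integral\<^sup>L lborel (\<lambda>x. ?gap (oscillation \<zeta> s w N x))" for N
  proof -
    define r where "r = (\<lambda>m. real m / real (Suc m))"
    have r: "\<bar>r m\<bar> < 1" for m by (simp add: r_def)
    have rlim: "r \<longlonglongrightarrow> 1" unfolding r_def by (rule LIMSEQ_n_over_Suc_n)
    have z: "zigzag (r m) \<in> borel_measurable borel" "zigzag' (r m) \<in> borel_measurable borel" for m
    proof -
      have "C_k 0 (zigzag (r m))" by (rule C_k_zigzag[OF r])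
      then show "zigzag (r m) \<in> borel_measurable borel" by (simp add: borel_measurable_continuous_onI)
      show "zigzag' (r m) \<in> borel_measurable borel" unfolding zigzag'_def by measurable
    qed
    let ?T = "\<lambda>m. oscillation \<zeta> (zigzag' (r m)) (zigzag (r m)) N"
    have "(\<lambda>m. integral\<^sup>L lborel (\<lambda>x. ?gap (?T m x))) \<longlonglongrightarrow> integral\<^sup>L lborel (\<lambda>x. ?gap
        (oscillation \<zeta> s w N x))"
    proof (rule integral_convergence_bounded_support[OF gapc convexity_gap_0 _ _ K(1) supp])
      show "?T m \<in> borel_measurable borel" for m by (rule oscillation_measurable[OF \<zeta> z(2,1)])
      show "norm (?T m x) \<le> 4 * (1 + B * 2)" for m x
        by (rule oscillation_bound[OF \<zeta>1 B zigzag'_bound[OF r] zigzag_bound]) (use r[of m] in simp)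
      show "(\<lambda>x. ?gap (oscillation \<zeta> s w N x)) \<in> borel_measurable borel"
        using measurable_compose[OF oscillation_measurable[OF \<zeta> sm wm] gapm] .
      show "AE x in lborel. (\<lambda>m. ?gap (?T m x)) \<longlonglongrightarrow> ?gap (oscillation \<zeta> s w N x)"
        using AE_cos_neq_0
      proof eventually_elim
        case (elim x)
        have "(\<lambda>m. ?T m x $ i $ j) \<longlonglongrightarrow> oscillation \<zeta> s w N x $ i $ j" for i j
          unfolding oscillation_def vec_lambda_beta s_def w_def
          using elim by (cases "i = j") (auto intro!: tendsto_intros zigzag'_tendsto[OF rlim] zigzag_tendsto[OF rlim r] simp del: of_nat_Suc)
        then have "(\<lambda>m. ?T m x) \<longlonglongrightarrow> oscillation \<zeta> s w N x"
          by (intro vec_tendstoI)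
        then show ?case
          by (rule continuous_on_tendsto_compose[OF gapc]) auto
      qed
    qed
    moreover have "0 \<le> integral\<^sup>L lborel (\<lambda>x. ?gap (?T m x))" for m
      by (rule integral_convexity_gap_nonneg[OF \<Omega>(1) conv \<zeta> C_k_zigzag[OF r] zigzag_has_derivative[OF r]])
    ultimately show ?thesis by (intro LIMSEQ_le_const) auto
  qed
  have zm: "\<zeta> \<in> borel_measurable borel" using cont(1) by (rule borel_measurable_continuous_onI)
  have "(\<lambda>N. integral\<^sup>L lborel (\<lambda>x. ?gap (oscillation \<zeta> s w N x))) \<longlonglongrightarrow> integral\<^sup>L lborel (\<lambda>x. \<zeta> x ^ 4 * ?gap
      (mat 1))"
  proof (rule integral_convergence_bounded_support[OF gapc convexity_gap_0 oscillation_measurable[OF \<zeta> sm wm]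
        oscillation_bound[OF \<zeta>1 B s1 w2] K(1) supp])
    show "AE x in lborel. (\<lambda>N. ?gap (oscillation \<zeta> s w N x)) \<longlonglongrightarrow> \<zeta> x ^ 4 * ?gap (mat 1)"
      using AE_cos_neq_0
    proof eventually_elim
      case (elim x)
      \<comment> \<open>Multiplying column j by the sign of its own slope turns the diagonal slopes
        into squares equal to 1, while the terms with the gradient of \<zeta> stay of order 1/N.
        Hence \<open>T N\<close> converges although the Jacobians do not, and the gap does not see
        the difference.\<close>
      define T where "T = (\<lambda>N. \<chi> i j. oscillation \<zeta> s w N x $ i $ j * s (real (Suc N) * x $ j))"
      have s2: "(s (real (Suc N) * x $ j))\<^sup>2 = 1" for N j
        using elim by (simp add: s_def sgn_if power2_eq_square)
      have "?gap (T N) = ?gap (oscillation \<zeta> s w N x)" for N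
        unfolding T_def by (rule convexity_gap_column_signs[OF s2])
      moreover have "(\<lambda>N. ?gap (T N)) \<longlonglongrightarrow> ?gap (\<zeta> x *\<^sub>R mat 1)"
      proof (rule continuous_on_tendsto_compose[OF gapc])
        have "(\<lambda>N. T N $ i $ j) \<longlonglongrightarrow> (\<zeta> x *\<^sub>R mat 1) $ i $ j" for i j
        proof -
          have 0: "(\<lambda>N. pderiv_dir \<zeta> (axis j 1) x * (w (real (Suc N) * x $ i) * s (real (Suc N) * x $ j))
              * inverse (real (Suc N))) \<longlonglongrightarrow> 0"
          proof (rule Lim_null_comparison[OF always_eventually])
            show "\<forall>N. norm (pderiv_dir \<zeta> (axis j 1) x * (w (real (Suc N) * x $ i) * s (real (Suc N)
                * x $ j)) * inverse (real (Suc N)))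
                \<le> (B * (2 * 1)) * inverse (real (Suc N))"
              unfolding real_norm_def abs_mult abs_of_nonneg[of "inverse (real (Suc _))", simplified]
              using order_trans[OF abs_ge_zero B]
              by (intro allI mult_right_mono mult_mono B w2 s1) auto
            show "(\<lambda>N. (B * (2 * 1)) * inverse (real (Suc N))) \<longlonglongrightarrow> 0"
              by (intro tendsto_mult_right_zero LIMSEQ_inverse_real_of_nat)
          qed
          have "T N $ i $ j = (\<zeta> x *\<^sub>R mat 1) $ i $ j +
              pderiv_dir \<zeta> (axis j 1) x * (w (real (Suc N) * x $ i) * s (real (Suc N) * x $ j)) * inverse
                  (real (Suc N))" for N
            using s2[of N j] unfolding T_def oscillation_def
            by (simp add: mat_def divide_inverse algebra_simps power2_eq_square del: of_nat_Suc)
          then show ?thesis using tendsto_add[OF tendsto_const 0] by simp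
        qed
        then show "T \<longlonglongrightarrow> \<zeta> x *\<^sub>R mat 1" by (intro vec_tendstoI)
      qed auto
      ultimately show ?case by (simp add: convexity_gap_scaleR)
    qed
  qed (use zm in measurable)
  then have "0 \<le> integral\<^sup>L lborel (\<lambda>x. \<zeta> x ^ 4 * ?gap (mat 1))"
    using nonneg by (intro LIMSEQ_le_const) auto
  \<comment> \<open>A negative gap leaves only this possibility, which is absurd since \<zeta> is
    positive on a nonempty open box.\<close>
  then have le: "integral\<^sup>L lborel (\<lambda>x. \<zeta> x ^ 4) \<le> 0"
    using gap by (simp add: zero_le_mult_iff)
  have "integrable lborel (\<lambda>x. \<zeta> x ^ 4)"
    by (rule integrable_compact_support[OF _ K(1)]) (use K cont in \<open>auto intro!: continuous_intros\<close>)
  then have "AE x in lborel. \<zeta> x ^ 4 = 0"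
    using le integral_nonneg_eq_0_iff_AE[of lborel "\<lambda>x. \<zeta> x ^ 4"]
      order_antisym[OF le Bochner_Integration.integral_nonneg] by simp
  then have "AE x in lborel. x \<notin> box a b"
    by eventually_elim (use box_bump_pos[of _ a b 0] in \<open>force simp: \<zeta>_def\<close>)
  then have "box a b \<in> null_sets lborel" by (subst AE_iff_null_sets) auto
  then have "negligible (box a b)" by (simp add: negligible_iff_null_sets null_sets_completionI)
  then show False using open_not_negligible[OF open_box, of a b] ab(2) by auto
qed

subsection \<open>Convexity and quasimonotonicity\<close>

text \<open>The gradient of the determinant: \<open>cofactor2 M \<bullet> H\<close> is the part of
  \<open>det (M + H)\<close> that is linear in \<open>H\<close>.\<close>

definition cofactor2 :: "real^2^2 \<Rightarrow> real^2^2" where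
  "cofactor2 M = (\<chi> i j. if i = 1 then (if j = 1 then M$2$2 else - M$2$1) else (if j = 1 then
      - M$1$2 else M$1$1))"

lemma inner_matrix_2:
  fixes M N :: "real^2^2"
  shows "M \<bullet> N = M$1$1 * N$1$1 + M$1$2 * N$1$2 + M$2$1 * N$2$1 + M$2$2 * N$2$2"
  by (simp add: inner_vec_def sum_2)

lemma cofactor2_nth [simp]:
  "cofactor2 M $ 1 $ 1 = M$2$2" "cofactor2 M $ 1 $ 2 = - M$2$1"
  "cofactor2 M $ 2 $ 1 = - M$1$2" "cofactor2 M $ 2 $ 2 = M$1$1"
  by (simp_all add: cofactor2_def)

text \<open>Besides computing the derivative, uniqueness of its representing vector must be shown,
  because \<open>gradient\<close> is a definite description.\<close>

lemma gradient_g: "gradient (g k) M = (4 * (M \<bullet> M)) *\<^sub>R M + (2 * k * det M) *\<^sub>R cofactor2 M"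
proof -
  have nth: "((\<lambda>M. M $ i $ j) has_derivative (\<lambda>H. H $ i $ j)) (at M)" for i j :: 2
    by (intro bounded_linear.has_derivative[OF bounded_linear_vec_nth] has_derivative_ident)
  have "GDERIV (g k) M :> (4 * (M \<bullet> M)) *\<^sub>R M + (2 * k * det M) *\<^sub>R cofactor2 M"
    unfolding gderiv_def g_entries
    by (rule has_derivative_eq_rhs, (rule derivative_intros nth)+)
      (simp add: fun_eq_iff inner_add_right inner_matrix_2 det_2 power2_eq_square algebra_simps)
  moreover have "D = D'" if "GDERIV (g k) M :> D" "GDERIV (g k) M :> D'" for D D'
    using has_derivative_unique[OF that[unfolded gderiv_def]] by (metis vector_eq_ldot)
  ultimately show ?thesis
    unfolding gradient_def by (intro the_equality)
qed

text \<open>Adding or subtracting 2 det M turns |M|^2 into a sum of two squares; equality holds for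
  conformal and anticonformal matrices.\<close>

lemma det_bound: "2 * \<bar>det M\<bar> \<le> M \<bullet> (M::real^2^2)"
proof -
  have "M \<bullet> M - 2 * det M = (M$1$1 - M$2$2)\<^sup>2 + (M$1$2 + M$2$1)\<^sup>2"
    "M \<bullet> M + 2 * det M = (M$1$1 + M$2$2)\<^sup>2 + (M$1$2 - M$2$1)\<^sup>2"
    by (simp_all add: inner_matrix_2 det_2 power2_eq_square algebra_simps)
  then have "0 \<le> M \<bullet> M - 2 * det M" "0 \<le> M \<bullet> M + 2 * det M" by simp_all
  then show ?thesis by linarith
qed

lemma det_add: "det (M + H) = det M + cofactor2 M \<bullet> H + det (H::real^2^2)"
  by (simp add: inner_matrix_2 det_2 algebra_simps)

lemma gradient_g_inner:
  fixes M H :: "real^2^2"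
  defines "S \<equiv> M \<bullet> M" and "N \<equiv> H \<bullet> H" and "m \<equiv> M \<bullet> H" and "c \<equiv> cofactor2 M \<bullet> H"
  shows "gradient (g k) (M + H) \<bullet> H =
    4 * (S + 2 * m + N) * (m + N) + 2 * k * (det M + c + det H) * (c + 2 * det H)"
proof -
  have 1: "(M + H) \<bullet> (M + H) = S + 2 * m + N"
    by (simp add: S_def m_def N_def inner_add_left inner_add_right inner_commute)
  have 2: "cofactor2 (M + H) \<bullet> H = c + 2 * det H"
    by (simp add: c_def inner_matrix_2 det_2 algebra_simps)
  show ?thesis
    unfolding gradient_g inner_add_left[of _ _ H] inner_scaleR_left 1 2 det_add
    by (simp add: c_def m_def N_def inner_add_left)
qed

text \<open>After completing squares the only negative term of the difference is -(k/2) (det H)^2.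
  Since 2 |det H| \<le> |H|^2, it is at least -(k/8) |H|^4, and the available |H|^4 absorbs this as
  long as k \<le> 8.\<close>

lemma gradient_g_inner_ge_null_lagrangian:
  fixes M H :: "real^2^2"
  assumes k: "0 \<le> k" "k \<le> 8"
  shows "4 * (M \<bullet> M) * (M \<bullet> H) + 2 * k * det M * (cofactor2 M \<bullet> H) + 4 * k * det M * det H
    \<le> gradient (g k) (M + H) \<bullet> H"
proof -
  define S where "S = M \<bullet> M"
  define N where "N = H \<bullet> H"
  define m where "m = M \<bullet> H"
  define c where "c = cofactor2 M \<bullet> H"
  have "m\<^sup>2 \<le> S * N" unfolding m_def S_def N_def by (rule Cauchy_Schwarz_ineq)
  then have CS: "0 \<le> S * N - m\<^sup>2" by simp
  have "(2 * \<bar>det H\<bar>)\<^sup>2 \<le> N\<^sup>2" unfolding N_def by (intro power_mono det_bound) simp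
  then have "4 * (det H)\<^sup>2 \<le> N\<^sup>2" by (simp add: power_mult_distrib)
  then have d: "k * (4 * (det H)\<^sup>2) \<le> 8 * N\<^sup>2" using k by (intro mult_mono) auto
  have sq: "0 \<le> 2 * k * (c + 3/2 * det H)\<^sup>2" "0 \<le> 12 * (m + N / 2)\<^sup>2" using k by auto
  \<comment> \<open>The constants come from completing the squares 12 m^2 + 12 m N + 3 N^2 = 12 (m +
    N/2)^2 and c^2 + 3 c d + 2 d^2 = (c + 3d/2)^2 - d^2/4 with d = det H.\<close>
  have eq: "gradient (g k) (M + H) \<bullet> H - (4 * S * m + 2 * k * det M * c + 4 * k * det M * det H)
     = 4 * (S * N - m\<^sup>2) + 12 * (m + N / 2)\<^sup>2 + N\<^sup>2 + 2 * k * (c + 3/2 * det H)\<^sup>2 - k * (4 * (det H)\<^sup>2) / 8"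
    unfolding gradient_g_inner S_def[symmetric] N_def[symmetric] m_def[symmetric] c_def[symmetric]
    by (simp add: power2_eq_square field_simps)
  have "0 \<le> 4 * a + p + n + q - r / 8" if "0 \<le> a" "0 \<le> p" "0 \<le> q" "r \<le> 8 * n" for a p q r n :: real
    using that by linarith
  from this[OF CS sq(2,1) d]
  have "0 \<le> gradient (g k) (M + H) \<bullet> H - (4 * S * m + 2 * k * det M * c + 4 * k * det M * det H)"
    unfolding eq .
  then show ?thesis unfolding S_def m_def c_def by simp
qed

lemma quasimonotone_gradient_g:
  assumes \<Omega>: "open \<Omega>" and k: "0 \<le> k" "k \<le> 8"
  shows "quasimonotone \<Omega> (gradient (g k))"
  unfolding quasimonotone_def
proof (intro allI ballI)
  fix M :: "real^2^2" and \<phi> :: "real^2 \<Rightarrow> real^2" assume \<phi>: "\<phi> \<in> test_functions \<Omega>"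
  define J where "J = (\<lambda>x. jacobian \<phi> (at x))"
  obtain K where K: "compact K" "K \<subseteq> \<Omega>" "\<And>x. x \<notin> K \<Longrightarrow> J x = 0"
    using jacobian_support[OF \<phi>] unfolding J_def by metis
  have cJ[continuous_intros]: "continuous_on UNIV J" unfolding J_def by (rule continuous_on_jacobian[OF \<phi>])
  have int: "integrable (lebesgue_on \<Omega>) f" "integral\<^sup>L (lebesgue_on \<Omega>) f = integral\<^sup>L lborel f"
    if f: "continuous_on UNIV f" "\<And>x. J x = 0 \<Longrightarrow> f x = 0" for f :: "real^2 \<Rightarrow> real"
  proof -
    have "integrable lborel f" by (rule integrable_compact_support[OF f(1) K(1)]) (use f K in auto)
    then show "integrable (lebesgue_on \<Omega>) f" using \<Omega> by (intro integrable_lebesgue_on) auto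
    show "integral\<^sup>L (lebesgue_on \<Omega>) f = integral\<^sup>L lborel f"
      by (rule lebesgue_on_lborel(1)[OF \<Omega> borel_measurable_continuous_onI[OF f(1)]]) (use f K in auto)
  qed
  note C1 = test_function_C1_compact[OF test_function_nth[OF \<phi>]]
  have J0: "integral\<^sup>L (lebesgue_on \<Omega>) (\<lambda>x. J x $ i $ j) = 0" for i j
  proof -
    have "continuous_on UNIV (\<lambda>x. J x $ i $ j)" by (intro continuous_intros)
    from int(2)[OF this] show ?thesis
      using integral_pderiv_dir_zero[OF C1 axis_1_Basis] by (simp add: J_def jacobian_nth[OF \<phi>])
  qed
  \<comment> \<open>Swapping the two directions of differentiation equates the integrals of the two
    products that make up the determinant.\<close>
  have d0: "integral\<^sup>L (lebesgue_on \<Omega>) (\<lambda>x. det (J x)) = 0"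
  proof -
    have "integral\<^sup>L lborel (\<lambda>x. J x $ 1 $ 1 * J x $ 2 $ 2) = integral\<^sup>L lborel (\<lambda>x. J x $ 1 $ 2
        * J x $ 2 $ 1)"
      unfolding J_def jacobian_nth[OF \<phi>] by (rule
          integral_pderiv_exchange[OF C1 C1 axis_1_Basis axis_1_Basis])
    moreover have c: "continuous_on UNIV (\<lambda>x. J x $ 1 $ 1 * J x $ 2 $ 2)" "continuous_on UNIV
        (\<lambda>x. J x $ 1 $ 2 * J x $ 2 $ 1)"
      by (intro continuous_intros)+
    ultimately show ?thesis
      unfolding det_2 using int[OF c(1)] int[OF c(2)] by simp
  qed
  have inn: "integral\<^sup>L (lebesgue_on \<Omega>) (\<lambda>x. A \<bullet> J x) = 0" "integrable (lebesgue_on \<Omega>) (\<lambda>x. A \<bullet> J x)" for A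
  proof -
    have ij: "integrable (lebesgue_on \<Omega>) (\<lambda>x. J x $ i $ j)" for i j
      by (rule int(1)) (auto intro!: continuous_intros)
    show "integral\<^sup>L (lebesgue_on \<Omega>) (\<lambda>x. A \<bullet> J x) = 0" "integrable (lebesgue_on \<Omega>) (\<lambda>x. A \<bullet> J x)"
      unfolding inner_matrix_2 using ij by (simp_all add: J0)
  qed
  have di: "integrable (lebesgue_on \<Omega>) (\<lambda>x. det (J x))"
    unfolding det_2 by (rule int(1)) (auto intro!: continuous_intros)
  have "0 = integral\<^sup>L (lebesgue_on \<Omega>) (\<lambda>x. 4 * (M \<bullet> M) * (M \<bullet> J x) + 2 * k * det M * (cofactor2 M \<bullet> J x)
      + 4 * k * det M * det (J x))"
    using inn di d0 by simp
  also have "\<dots> \<le> integral\<^sup>L (lebesgue_on \<Omega>) (\<lambda>x. gradient (g k) (M + J x) \<bullet> J x)"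
  proof (rule integral_mono)
    show "integrable (lebesgue_on \<Omega>) (\<lambda>x. 4 * (M \<bullet> M) * (M \<bullet> J x) + 2 * k * det M * (cofactor2 M \<bullet> J x)
        + 4 * k * det M * det (J x))"
      using inn di by simp
    show "integrable (lebesgue_on \<Omega>) (\<lambda>x. gradient (g k) (M + J x) \<bullet> J x)"
      unfolding gradient_g_inner det_2 by (rule int(1)) (auto intro!: continuous_intros)
  qed (rule gradient_g_inner_ge_null_lagrangian[OF k])
  finally show "0 \<le> integral\<^sup>L (lebesgue_on \<Omega>) (\<lambda>x. gradient (g k) (M + jacobian \<phi> (at x)) \<bullet> jacobian \<phi>
      (at x))"
    unfolding J_def .
qed

text \<open>For k = -2 one has |M|^4 - 2 (det M)^2 = |M^T M|^2, whose second variation is 2 |M^T H +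
  H^T M|^2 + 4 |M H^T|^2. For k = 4 the product of determinants is absorbed by |M|^2 |H|^2 through
  \<open>det_bound\<close>.\<close>

lemma g_second_variation_nonneg:
  fixes M H :: "real^2^2"
  assumes k: "-2 \<le> k" "k \<le> 4"
  shows "0 \<le> 8 * (M \<bullet> H)\<^sup>2 + 4 * (M \<bullet> M) * (H \<bullet> H) + 2 * k * (cofactor2 M \<bullet> H)\<^sup>2 + 4 * k * det M * det H"
    (is "0 \<le> ?F k")
proof -
  have "?F (-2) =
     2 * ((2 * (M$1$1 * H$1$1 + M$2$1 * H$2$1))\<^sup>2 + (2 * (M$1$2 * H$1$2 + M$2$2 * H$2$2))\<^sup>2
     + 2 * (M$1$1 * H$1$2 + M$2$1 * H$2$2 + M$1$2 * H$1$1 + M$2$2 * H$2$1)\<^sup>2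
     + 2 * ((M$1$1 * H$1$1 + M$1$2 * H$1$2)\<^sup>2 + (M$1$1 * H$2$1 + M$1$2 * H$2$2)\<^sup>2
        + (M$2$1 * H$1$1 + M$2$2 * H$1$2)\<^sup>2 + (M$2$1 * H$2$1 + M$2$2 * H$2$2)\<^sup>2))"
    by (simp add: inner_matrix_2 det_2 power2_eq_square algebra_simps)
  then have 1: "0 \<le> ?F (-2)"
    by (simp only:) (intro add_nonneg_nonneg mult_nonneg_nonneg zero_le_power2; simp)
  have "(2 * \<bar>det M\<bar>) * (2 * \<bar>det H\<bar>) \<le> (M \<bullet> M) * (H \<bullet> H)"
    by (intro mult_mono det_bound) auto
  then have "\<bar>4 * (det M * det H)\<bar> \<le> (M \<bullet> M) * (H \<bullet> H)" by (simp add: abs_mult)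
  then have nn: "0 \<le> 4 * ((M \<bullet> M) * (H \<bullet> H)) + 16 * (det M * det H)" by linarith
  have F4: "?F 4 = (4 * ((M \<bullet> M) * (H \<bullet> H)) + 16 * (det M * det H)) +
      8 * (M \<bullet> H)\<^sup>2 + 8 * (cofactor2 M \<bullet> H)\<^sup>2"
    by simp
  have 2: "0 \<le> ?F 4"
    unfolding F4 by (intro add_nonneg_nonneg nn) simp_all
  \<comment> \<open>Interpolation between the endpoints -2 and 4; both weights are nonnegative
    exactly for k in between.\<close>
  have "?F k = (4 - k) / 6 * ?F (-2) + (k + 2) / 6 * ?F 4" by (simp add: field_simps)
  moreover have "0 \<le> (4 - k) / 6 * ?F (-2)" by (rule mult_nonneg_nonneg[OF _ 1]) (use k in simp)
  moreover have "0 \<le> (k + 2) / 6 * ?F 4" by (rule mult_nonneg_nonneg[OF _ 2]) (use k in simp)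
  ultimately show ?thesis by (metis add_nonneg_nonneg)
qed

text \<open>Along a line \<open>x + s *\<^sub>R H\<close> the function is a polynomial
  \<open>p\<close> in s, and \<open>p'' s\<close> is the second variation at that point in direction
  \<open>H\<close>.\<close>

lemma convex_on_g:
  assumes k: "-2 \<le> k" "k \<le> 4"
  shows "convex_on UNIV (g k)"
proof (rule convex_onI)
  fix t :: real and x y :: "real^2^2"
  assume t: "0 < t" "t < 1"
  define H where "H = y - x"
  define S where "S = x \<bullet> x"
  define N where "N = H \<bullet> H"
  define m where "m = x \<bullet> H"
  define c where "c = cofactor2 x \<bullet> H"
  define p where "p = (\<lambda>s::real. (S + 2 * s * m + s\<^sup>2 * N)\<^sup>2 + k * (det x + s * c + s\<^sup>2 * det H)\<^sup>2)"
  have gp: "g k (x + s *\<^sub>R H) = p s" for s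
  proof -
    have 1: "det (x + s *\<^sub>R H) = det x + s * c + s\<^sup>2 * det H"
      by (simp add: c_def inner_matrix_2 det_2 power2_eq_square algebra_simps)
    have 2: "(norm (x + s *\<^sub>R H))\<^sup>2 = S + 2 * s * m + s\<^sup>2 * N"
      unfolding power2_norm_eq_inner
      by (simp add: S_def m_def N_def inner_add_left inner_add_right inner_commute power2_eq_square)
    have "norm (x + s *\<^sub>R H) ^ 4 = ((norm (x + s *\<^sub>R H))\<^sup>2)\<^sup>2" by simp
    then show ?thesis unfolding g_def p_def 1 2 by simp
  qed
  define p' where "p' = (\<lambda>s::real. 2 * (S + 2 * s * m + s\<^sup>2 * N) * (2 * m + 2 * s * N)
    + 2 * k * (det x + s * c + s\<^sup>2 * det H) * (c + 2 * s * det H))"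
  define p'' where "p'' = (\<lambda>s::real. 8 * (m + s * N)\<^sup>2 + 4 * (S + 2 * s * m + s\<^sup>2 * N) * N
    + 2 * k * (c + 2 * s * det H)\<^sup>2 + 4 * k * (det x + s * c + s\<^sup>2 * det H) * det H)"
  have "convex_on UNIV p"
  proof (rule f''_ge0_imp_convex)
    show "(p has_real_derivative p' s) (at s)" for s
      unfolding p_def p'_def
      by (auto intro!: derivative_eq_intros simp: algebra_simps)
    show "(p' has_real_derivative p'' s) (at s)" for s
      unfolding p'_def p''_def
      by (auto intro!: derivative_eq_intros simp: algebra_simps power2_eq_square)
    show "0 \<le> p'' s" for s
    proof -
      have "(x + s *\<^sub>R H) \<bullet> H = m + s * N" "(x + s *\<^sub>R H) \<bullet> (x + s *\<^sub>R H) = S + 2 * s * m + s\<^sup>2 * N"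
        "det (x + s *\<^sub>R H) = det x + s * c + s\<^sup>2 * det H" "cofactor2 (x + s *\<^sub>R H) \<bullet> H = c + 2 * s * det H"
        unfolding S_def N_def m_def c_def
        by (simp_all add: inner_matrix_2 det_2 power2_eq_square algebra_simps)
      with g_second_variation_nonneg[OF k, of "x + s *\<^sub>R H" H] show ?thesis
        by (simp add: p''_def N_def[symmetric])
    qed
  qed simp
  from convex_onD[OF this, of t 0 1] t have "p t \<le> (1 - t) * p 0 + t * p 1" by simp
  moreover have "(1 - t) *\<^sub>R x + t *\<^sub>R y = x + t *\<^sub>R H" "x = x + 0 *\<^sub>R H" "y = x + 1 *\<^sub>R H"
    by (simp_all add: H_def algebra_simps)
  ultimately show "g k ((1 - t) *\<^sub>R x + t *\<^sub>R y) \<le> (1 - t) * g k x + t * g k y"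
    by (metis gp)
qed simp

section \<open>Failure of convexity on diagonal matrices\<close>

lemma convexity_gap_neg_gt_4:
  assumes "4 < k"
  shows "\<exists>c d. convexity_gap k c d (mat 1) < 0"
proof -
  \<comment> \<open>The two points are (1, 1) displaced by t along (1, -1) and its opposite. This
    t^2 minimises the gap t^2 (8 - 2k + (4 + k) t^2).\<close>
  define t where "t = sqrt ((k - 4) / (4 + k))"
  have t: "t\<^sup>2 = (k - 4) / (4 + k)" using assms by (simp add: t_def)
  have "convexity_gap k (vector [1 + t, 1 - t]) (vector [1 - t, 1 + t]) (mat 1) = t\<^sup>2 * ((8 - 2 * k) + (4
      + k) * t\<^sup>2)"
    by (simp add: convexity_gap_def g_entries row_scale_def mat_def vector_2)
        (simp add: power2_eq_square field_simps)
  also have "\<dots> = t\<^sup>2 * (4 - k)" using assms by (simp add: t)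
  also have "\<dots> < 0" unfolding t using assms by (intro mult_pos_neg divide_pos_pos) auto
  finally show ?thesis by blast
qed

lemma convexity_gap_neg_less_minus_2:
  assumes "k < -2"
  shows "\<exists>c d. convexity_gap k c d (mat 1) < 0"
proof -
  \<comment> \<open>Here the midpoint is (1, 0) and the displacement is along (0, 1); this t^2
    minimises the gap t^2 (2 + k + t^2).\<close>
  define t where "t = sqrt ((- 2 - k) / 2)"
  have t: "t\<^sup>2 = (- 2 - k) / 2" using assms by (simp add: t_def)
  have "convexity_gap k (vector [1, t]) (vector [1, - t]) (mat 1) = t\<^sup>2 * ((2 + k) + t\<^sup>2)"
    by (simp add: convexity_gap_def g_entries row_scale_def mat_def vector_2)
        (simp add: power2_eq_square field_simps)
  also have "\<dots> = t\<^sup>2 * ((2 + k) / 2)" unfolding t by (simp add: field_simps)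
  also have "\<dots> < 0" unfolding t using assms by (intro mult_pos_neg) auto
  finally show ?thesis by blast
qed

theorem proposition1p6:
  fixes \<Omega> :: "(real^2) set" and k :: real
  assumes "bounded_domain \<Omega>"
  shows "(integral_convex \<Omega> (g k) \<longleftrightarrow> -2 \<le> k \<and> k \<le> 4) \<and>
    (-2 \<le> k \<and> k \<le> 4 \<longrightarrow> convex_on UNIV (g k)) \<and>
    (4 < k \<and> k \<le> 8 \<longrightarrow> quasimonotone \<Omega> (gradient (g k)) \<and> \<not> integral_convex \<Omega> (g k))"
proof -
  have \<Omega>: "open \<Omega>" "bounded \<Omega>" "\<Omega> \<noteq> {}" using assms unfolding bounded_domain_def by auto
  have "\<not> integral_convex \<Omega> (g k)" if "\<not> (-2 \<le> k \<and> k \<le> 4)"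
  proof -
    have "\<exists>c d. convexity_gap k c d (mat 1) < 0"
      using that convexity_gap_neg_gt_4[of k] convexity_gap_neg_less_minus_2[of k] by (cases "4 < k")
          (auto simp: not_le)
    then show ?thesis using not_integral_convexI[OF \<Omega>(1,3)] by blast
  qed
  moreover have "integral_convex \<Omega> (g k)" if "-2 \<le> k \<and> k \<le> 4"
    using integral_convex_if_convex[OF \<Omega>(1,2) continuous_on_g convex_on_g] that by blast
  ultimately show ?thesis
    using convex_on_g[of k] quasimonotone_gradient_g[OF \<Omega>(1), of k] by auto
qed

end
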